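(* Let $k\ge 1$, let $S\subset\mathbb{R}^k$ be a halfspace, and let $\Sigma\subseteq S$ be an additive semigroup (i.e. $\lambda,\mu\in\Sigma$ implies $\lambda+\mu\in\Sigma$) containing zero. Then the topological spaces $\mathbb{M}(AP^k_{\Sigma})$ and $\mathbb{M}(APW^k_{\Sigma})$ are contractible.
   Context: $AP^k$ is the algebra of complex valued almost periodic functions of $k$ real variables: the closed subalgebra of $L^\infty(\mathbb{R}^k)$ generated by the functions $e_\lambda(x)=e^{i\langle\lambda,x\rangle}$, $\lambda\in\mathbb{R}^k$, where $\langle\cdot,\cdot\rangle$ is the standard inner product on $\mathbb{R}^k$; its norm is $\|\cdot\|_\infty$. For $f\in AP^k$ and $\lambda\in\mathbb{R}^k$ put $f_\lambda=\lim_{T\to\infty}\frac{1}{(2T)^k}\int_{[-T,T]^k}e^{-i\langle\lambda,x\rangle}f(x)\,dx$; the Bohr-Fourier spectrum of $f$ is $\sigma(f)=\{\lambda\in\mathbb{R}^k: f_\lambda\ne 0\}$, and its Bohr-Fourier series is the formal sum $\sum_{\lambda\in\sigma(f)} f_\lambda e^{i\langle\lambda,t\rangle}$. The Wiener algebra $APW^k$ is the set of $f\in AP^k$ whose Bohr-Fourier series converges absolutely, a Banach algebra with norm $\|f\|_W=\sum_\lambda|f_\lambda|$ and pointwise multiplication. For nonempty $\Delta\subseteq\mathbb{R}^k$: $AP^k_\Delta=\{f\in AP^k:\sigma(f)\subseteq\Delta\}$ and $APW^k_\Delta=\{f\in APW^k:\sigma(f)\subseteq\Delta\}$, regarded as commutative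 unital Banach algebras in the norms $\|\cdot\|_\infty$ and $\|\cdot\|_W$ respectively when $\Delta$ is an additive semigroup containing $0$. For a commutative unital complex Banach algebra $\mathcal{A}$, $\mathbb{M}(\mathcal{A})$ denotes its maximal ideal space, i.e. the set of nonzero multiplicative linear functionals $\phi:\mathcal{A}\to\mathbb{C}$, with the topology induced by the weak$^*$ topology of the dual $\mathcal{A}^*$. A subset $S\subset\mathbb{R}^k$ is a halfspace if (i) $\mathbb{R}^k=S\cup(-S)$; (ii) $S\cap(-S)=\{0\}$; (iii) $\lambda,\mu\in S$ implies $\lambda+\mu\in S$; (iv) $\lambda\in S$ and $\alpha\ge 0$ real imply $\alpha\lambda\in S$. *)

theory Defs
  imports "HOL-Analysis.Analysis"
begin

section \<open>Almost periodic functions on \<open>real ^ 'n\<close>\<close>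

definition ap_exp :: "real ^ 'n \<Rightarrow> real ^ 'n \<Rightarrow> complex" where
  "ap_exp l = (\<lambda>x. exp (\<i> * of_real (l \<bullet> x)))"

definition sup_norm :: "('a \<Rightarrow> complex) \<Rightarrow> real" where
  "sup_norm f = (SUP x. cmod (f x))"

text \<open>Bounded continuous functions with the supremum norm form a closed subalgebra of the
  algebra of essentially bounded measurable functions, isometrically (the supremum of a
  continuous function is its essential supremum), and they include all exponentials. So the
  closed subalgebra generated by the exponentials can be formed inside \<^const>\<open>bcontfun\<close>, and
  each of its elements has a unique continuous representative. A sequence in
  \<^const>\<open>bcontfun\<close> converges in \<open>sup_norm\<close> iff it converges uniformly.\<close>

definition closed_subalgebra :: "('a::topological_space \<Rightarrow> complex) set \<Rightarrow> bool" where
  "closed_subalgebra A \<longleftrightarrow>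
     A \<subseteq> bcontfun \<and>
     (\<forall>f\<in>A. \<forall>g\<in>A. (\<lambda>x. f x + g x) \<in> A) \<and>
     (\<forall>c. \<forall>f\<in>A. (\<lambda>x. c * f x) \<in> A) \<and>
     (\<forall>f\<in>A. \<forall>g\<in>A. (\<lambda>x. f x * g x) \<in> A) \<and>
     (\<forall>F f. (\<forall>n. F n \<in> A) \<and> uniform_limit UNIV F f sequentially \<longrightarrow> f \<in> A)"

definition AP :: "(real ^ 'n \<Rightarrow> complex) set" where
  "AP = closed_subalgebra hull (range ap_exp)"

definition bohr_coeff :: "(real ^ 'n \<Rightarrow> complex) \<Rightarrow> real ^ 'n \<Rightarrow> complex" where
  "bohr_coeff f l = Lim at_top (\<lambda>T::real. of_real (1 / (2 * T) ^ CARD('n)) *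
     integral (cbox (\<chi> i. - T) (\<chi> i. T)) (\<lambda>x. exp (- \<i> * of_real (l \<bullet> x)) * f x))"

definition bohr_spectrum :: "(real ^ 'n \<Rightarrow> complex) \<Rightarrow> (real ^ 'n) set" where
  "bohr_spectrum f = {l. bohr_coeff f l \<noteq> 0}"

definition APW :: "(real ^ 'n \<Rightarrow> complex) set" where
  "APW = {f \<in> AP. (\<lambda>l. cmod (bohr_coeff f l)) summable_on bohr_spectrum f}"

definition wiener_norm :: "(real ^ 'n \<Rightarrow> complex) \<Rightarrow> real" where
  "wiener_norm f = (\<Sum>\<^sub>\<infinity>l\<in>bohr_spectrum f. cmod (bohr_coeff f l))"

definition AP_spec :: "(real ^ 'n) set \<Rightarrow> (real ^ 'n \<Rightarrow> complex) set" where
  "AP_spec D = {f \<in> AP. bohr_spectrum f \<subseteq> D}"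

definition APW_spec :: "(real ^ 'n) set \<Rightarrow> (real ^ 'n \<Rightarrow> complex) set" where
  "APW_spec D = {f \<in> APW. bohr_spectrum f \<subseteq> D}"


section \<open>The maximal ideal space of a Banach algebra of functions\<close>

text \<open>A Banach algebra of complex functions under the pointwise operations is given by its
  carrier \<open>A\<close> and its norm \<open>N\<close>. A functional on \<open>A\<close> is a function that is
  \<^const>\<open>undefined\<close> outside \<open>A\<close>, so that distinct HOL functions are distinct functionals.\<close>

definition linear_functional :: "('a \<Rightarrow> complex) set \<Rightarrow> (('a \<Rightarrow> complex) \<Rightarrow> complex) \<Rightarrow> bool" where
  "linear_functional A \<phi> \<longleftrightarrow> \<phi> \<in> extensional A \<and>
     (\<forall>f\<in>A. \<forall>g\<in>A. \<phi> (\<lambda>x. f x + g x) = \<phi> f + \<phi> g) \<and>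
     (\<forall>c. \<forall>f\<in>A. \<phi> (\<lambda>x. c * f x) = c * \<phi> f)"

definition dual_space ::
    "('a \<Rightarrow> complex) set \<Rightarrow> (('a \<Rightarrow> complex) \<Rightarrow> real) \<Rightarrow> (('a \<Rightarrow> complex) \<Rightarrow> complex) set" where
  "dual_space A N = {\<phi>. linear_functional A \<phi> \<and> (\<exists>C. \<forall>f\<in>A. cmod (\<phi> f) \<le> C * N f)}"

definition weak_star_topology ::
    "('a \<Rightarrow> complex) set \<Rightarrow> (('a \<Rightarrow> complex) \<Rightarrow> real) \<Rightarrow> (('a \<Rightarrow> complex) \<Rightarrow> complex) topology" where
  "weak_star_topology A N = subtopology (product_topology (\<lambda>_. euclidean) A) (dual_space A N)"

definition characters :: "('a \<Rightarrow> complex) set \<Rightarrow> (('a \<Rightarrow> complex) \<Rightarrow> complex) set" where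
  "characters A = {\<phi>. linear_functional A \<phi> \<and>
     (\<forall>f\<in>A. \<forall>g\<in>A. \<phi> (\<lambda>x. f x * g x) = \<phi> f * \<phi> g) \<and> (\<exists>f\<in>A. \<phi> f \<noteq> 0)}"

text \<open>On a Banach algebra every multiplicative linear functional is bounded, so the underlying
  set of the following space is all of \<^term>\<open>characters A\<close>.\<close>

definition max_ideal_space ::
    "('a \<Rightarrow> complex) set \<Rightarrow> (('a \<Rightarrow> complex) \<Rightarrow> real) \<Rightarrow> (('a \<Rightarrow> complex) \<Rightarrow> complex) topology" where
  "max_ideal_space A N = subtopology (weak_star_topology A N) (characters A)"


section \<open>Halfspaces\<close>

definition is_halfspace :: "'a::real_vector set \<Rightarrow> bool" where
  "is_halfspace S \<longleftrightarrow>
     S \<union> uminus ` S = UNIV \<and>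
     S \<inter> uminus ` S = {0} \<and>
     (\<forall>l\<in>S. \<forall>m\<in>S. l + m \<in> S) \<and>
     (\<forall>l\<in>S. \<forall>a\<ge>0. a *\<^sub>R l \<in> S)"

end

theory Submission
  imports Defs "HOL-Complex_Analysis.Complex_Analysis"
begin

text \<open>
  Both algebras are spanned, up to closure, by the exponentials \<open>e\<^sub>l\<close> with \<open>l \<in> \<Sigma>\<close>, and
  \<open>e\<^sub>l e\<^sub>m = e\<^sub>l\<^sub>+\<^sub>m\<close>. A semicharacter \<open>\<omega> : \<Sigma> \<rightarrow> [0,1]\<close>, that is \<open>\<omega> (l + m) = \<omega> l * \<omega> m\<close> and
  \<open>\<omega> 0 = 1\<close>, therefore acts on trigonometric polynomials by a homomorphism that multiplies the
  coefficient at \<open>l\<close> by \<open>\<omega> l\<close>. If this action is a contraction for the norm, it extends to the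
  whole algebra and pulls characters back to characters. A path of such semicharacters from the
  constant 1 to the indicator of \<open>{0}\<close> thus deforms every character \<open>\<phi>\<close> into the single
  character that sends \<open>f\<close> to its mean \<open>f\<^sub>0\<close>. The deformation is jointly continuous: on a
  trigonometric polynomial it is a finite sum of continuous terms, and characters as well as the
  multipliers are contractions, so the polynomial case passes to uniform limits
  (\<open>contractible_max_ideal_space\<close>).

  The path (\<open>exists_contracting_path\<close>). Removing 0 from the halfspace leaves a convex set \<open>C\<close>
  that misses 0. Unless \<open>C\<close> is empty, some \<open>a \<noteq> 0\<close> in the span of \<open>C\<close> has \<open>a \<bullet> l \<ge> 0\<close> on \<open>C\<close>. The semicharacters
  \<open>r\<close> to the power \<open>a \<bullet> l\<close> join the constant 1, at \<open>r = 1\<close>, to the indicator of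
  \<open>a \<bullet> l = 0\<close>, at \<open>r = 0\<close>. The part of \<open>C\<close> orthogonal to \<open>a\<close> is again convex, misses 0 and
  spans a space of smaller dimension, so the path is continued by induction.

  Contractivity in the supremum norm (\<open>contractive_multiplier_decay\<close>). The exponential sum
  \<open>t \<mapsto> p (x + t a)\<close> extends to a bounded holomorphic function on the upper half-plane because
  the exponents \<open>a \<bullet> l\<close> are nonnegative, and multiplying the coefficients by the powers of \<open>r\<close>
  evaluates this function on the imaginary axis. The Phragmen--Lindelof principle bounds it by its
  supremum on the real line. In the Wiener norm, contractivity is immediate from \<open>0 \<le> \<omega> \<le> 1\<close>.

  Passing from polynomials to the whole algebra requires that a function with spectrum in
  \<open>\<Sigma>\<close> is a uniform limit of trigonometric polynomials with spectrum in \<open>\<Sigma>\<close>. This is the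
  Bochner--Fejer theorem (\<open>bochner_fejer\<close>), which also shows that a function is determined by
  its Bohr--Fourier coefficients. The kernels used here are \<open>|\<Sum>\<^sub>a e\<^sub>a|\<^sup>2 / |A|\<close>, where
  the sum is over a finite set \<open>A\<close> of frequencies that is almost invariant under the relevant
  translations; such sets exist because finitely generated abelian groups have polynomial growth.
\<close>

section \<open>Trigonometric polynomials and their uniform closure\<close>

lemma ap_exp_add: "ap_exp (l + m) x = ap_exp l x * ap_exp m x"
  by (simp add: ap_exp_def inner_add_left distrib_left exp_add of_real_add)

lemma ap_exp_0 [simp]: "ap_exp 0 = (\<lambda>x. 1)"
  by (simp add: ap_exp_def)

lemma norm_ap_exp [simp]: "cmod (ap_exp l x) = 1"
  by (simp add: ap_exp_def)

lemma cnj_ap_exp: "cnj (ap_exp l x) = ap_exp (- l) x"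
  by (simp add: ap_exp_def exp_cnj)

lemma ap_exp_shift: "ap_exp l (x + y) = ap_exp l x * ap_exp l y"
  by (simp add: ap_exp_def inner_add_right distrib_left exp_add of_real_add)

lemma ap_exp_diff_arg: "ap_exp l (x - y) = ap_exp l x * ap_exp (- l) y"
  by (simp add: ap_exp_def inner_diff_right right_diff_distrib exp_diff divide_inverse exp_minus)

lemma continuous_on_ap_exp [continuous_intros]: "continuous_on S (ap_exp l)"
  unfolding ap_exp_def by (intro continuous_intros)

definition trig_sum :: "(real ^ 'n) set \<Rightarrow> (real ^ 'n \<Rightarrow> complex) \<Rightarrow> real ^ 'n \<Rightarrow> complex" where
  "trig_sum F c = (\<lambda>x. \<Sum>l\<in>F. c l * ap_exp l x)"

definition trig_polys :: "(real ^ 'n) set \<Rightarrow> (real ^ 'n \<Rightarrow> complex) set" where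
  "trig_polys D = {p. \<exists>F c. finite F \<and> F \<subseteq> D \<and> p = trig_sum F c}"

lemma trig_sum_in: "finite F \<Longrightarrow> F \<subseteq> D \<Longrightarrow> trig_sum F c \<in> trig_polys D"
  unfolding trig_polys_def by blast

lemma trig_sum_extend:
  assumes "finite G" "F \<subseteq> G"
  shows "trig_sum F c = trig_sum G (\<lambda>l. if l \<in> F then c l else 0)"
  unfolding trig_sum_def
  by (rule ext, rule sum.mono_neutral_cong_left) (use assms in auto)

lemma trig_polys_cmult: "p \<in> trig_polys D \<Longrightarrow> (\<lambda>x. c * p x) \<in> trig_polys D"
proof -
  assume "p \<in> trig_polys D"
  then obtain F d where "finite F" "F \<subseteq> D" "p = trig_sum F d"
    by (auto simp: trig_polys_def)
  moreover from this have "(\<lambda>x. c * p x) = trig_sum F (\<lambda>l. c * d l)"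
    by (simp add: trig_sum_def sum_distrib_left mult.assoc)
  ultimately show ?thesis by (simp add: trig_sum_in)
qed

lemma trig_polys_add:
  assumes "p \<in> trig_polys D" "q \<in> trig_polys D"
  shows "(\<lambda>x. p x + q x) \<in> trig_polys D"
proof -
  obtain F c where F: "finite F" "F \<subseteq> D" "p = trig_sum F c"
    using assms by (auto simp: trig_polys_def)
  obtain G d where G: "finite G" "G \<subseteq> D" "q = trig_sum G d"
    using assms by (auto simp: trig_polys_def)
  have "(\<lambda>x. p x + q x) = trig_sum (F \<union> G) (\<lambda>l. (if l \<in> F then c l else 0) + (if l \<in> G then d l else 0))"
    unfolding F(3) G(3) trig_sum_extend[of "F \<union> G" F, OF finite_UnI[OF F(1) G(1)] Un_upper1]
      trig_sum_extend[of "F \<union> G" G, OF finite_UnI[OF F(1) G(1)] Un_upper2]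
    by (simp add: trig_sum_def sum.distrib distrib_right)
  then show ?thesis using F G by (simp add: trig_sum_in)
qed

lemma zero_in_trig_polys: "(\<lambda>x. 0) \<in> trig_polys D"
  using trig_sum_in[of "{}" D] by (simp add: trig_sum_def)

lemma trig_polys_term: "c = 0 \<or> l \<in> D \<Longrightarrow> (\<lambda>x. c * ap_exp l x) \<in> trig_polys D"
  using trig_sum_in[of "{l}" D "\<lambda>_. c"] zero_in_trig_polys[of D]
  by (auto simp: trig_sum_def)

lemma ap_exp_in_trig_polys: "l \<in> D \<Longrightarrow> ap_exp l \<in> trig_polys D"
  using trig_polys_term[of 1 l D] by simp

lemma trig_polys_sum:
  assumes "\<And>i. i \<in> I \<Longrightarrow> p i \<in> trig_polys D"
  shows "(\<lambda>x. \<Sum>i\<in>I. p i x) \<in> trig_polys D"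
  using assms
  by (induction I rule: infinite_finite_induct) (auto intro: trig_polys_add zero_in_trig_polys)

lemma trig_polys_diff:
  assumes "p \<in> trig_polys D" "q \<in> trig_polys D"
  shows "(\<lambda>x. p x - q x) \<in> trig_polys D"
  using trig_polys_add[OF assms(1) trig_polys_cmult[OF assms(2), of "-1"]] by simp

lemma trig_polys_mult:
  assumes "p \<in> trig_polys UNIV" "q \<in> trig_polys UNIV"
  shows "(\<lambda>x. p x * q x) \<in> trig_polys UNIV"
proof -
  obtain F c where F: "finite F" "p = trig_sum F c"
    using assms by (auto simp: trig_polys_def)
  obtain G d where G: "finite G" "q = trig_sum G d"
    using assms by (auto simp: trig_polys_def)
  have "(\<lambda>x. p x * q x) = (\<lambda>x. \<Sum>l\<in>F. \<Sum>m\<in>G. (c l * d m) * ap_exp (l + m) x)"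
    by (simp add: F G trig_sum_def sum_product ap_exp_add mult_ac)
  also have "\<dots> \<in> trig_polys UNIV"
    by (intro trig_polys_sum trig_polys_term) auto
  finally show ?thesis .
qed

lemma trig_polys_bcontfun: "p \<in> trig_polys D \<Longrightarrow> p \<in> bcontfun"
proof -
  assume "p \<in> trig_polys D"
  then obtain F c where F: "finite F" "p = trig_sum F c"
    by (auto simp: trig_polys_def)
  have "continuous_on UNIV p"
    unfolding F trig_sum_def by (intro continuous_intros)
  moreover have "cmod (p x) \<le> (\<Sum>l\<in>F. cmod (c l))" for x
    unfolding F trig_sum_def by (rule sum_norm_le) (simp add: norm_mult)
  then have "bounded (range p)"
    by (auto simp: bounded_iff)
  ultimately show ?thesis by (simp add: bcontfun_def)
qed

definition uniform_closure :: "('a \<Rightarrow> complex) set \<Rightarrow> ('a \<Rightarrow> complex) set" where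
  "uniform_closure P = {f. \<forall>e>0. \<exists>p\<in>P. \<forall>x. cmod (f x - p x) < e}"

lemma uniform_closureE:
  assumes "f \<in> uniform_closure P"
  obtains p where "\<And>n. p n \<in> P" "uniform_limit UNIV p f sequentially"
proof -
  have "\<exists>p\<in>P. \<forall>x. cmod (f x - p x) < inverse (real (Suc n))" for n
    using assms by (auto simp: uniform_closure_def)
  then obtain p where p: "\<And>n. p n \<in> P" "\<And>n x. cmod (f x - p n x) < inverse (real (Suc n))"
    by metis
  have "uniform_limit UNIV p f sequentially"
    unfolding uniform_limit_sequentially_iff
  proof (intro allI impI)
    fix e :: real assume "e > 0"
    then obtain N where N: "inverse (real (Suc N)) < e" using reals_Archimedean by blast
    have "dist (p n x) (f x) < e" if "n \<ge> N" for n x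
    proof -
      have "dist (p n x) (f x) < inverse (real (Suc n))"
        using p(2)[of x n] by (simp add: dist_norm norm_minus_commute)
      also have "\<dots> \<le> inverse (real (Suc N))" using that by (simp add: divide_simps)
      finally show ?thesis using N by linarith
    qed
    then show "\<exists>N. \<forall>n\<ge>N. \<forall>x\<in>UNIV. dist (p n x) (f x) < e" by blast
  qed
  with p(1) that show thesis by blast
qed

lemma uniform_closureI:
  assumes "\<And>n. p n \<in> P" "uniform_limit UNIV p f sequentially"
  shows "f \<in> uniform_closure P"
  unfolding uniform_closure_def
proof (clarify)
  fix e :: real assume "e > 0"
  then obtain n where "\<forall>x. dist (p n x) (f x) < e"
    using assms(2) unfolding uniform_limit_sequentially_iff by blast
  then show "\<exists>p\<in>P. \<forall>x. cmod (f x - p x) < e"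
    using assms(1) by (intro bexI[of _ "p n"]) (auto simp: dist_norm norm_minus_commute)
qed

lemma uniform_closure_bcontfun:
  fixes P :: "('a::topological_space \<Rightarrow> complex) set"
  assumes "P \<subseteq> bcontfun" "f \<in> uniform_closure P"
  shows "f \<in> bcontfun"
proof -
  obtain p where p: "\<And>n. p n \<in> P" "uniform_limit UNIV p f sequentially"
    by (rule uniform_closureE[OF assms(2)]) blast
  have cont: "continuous_on UNIV f"
    by (rule uniform_limit_theorem[OF _ p(2)])
      (use p(1) assms(1) in \<open>auto simp: bcontfun_def intro!: always_eventually\<close>)
  obtain q where q: "q \<in> P" "\<forall>x. cmod (f x - q x) < 1"
    using assms(2) zero_less_one unfolding uniform_closure_def by blast
  obtain B where B: "\<And>x. cmod (q x) \<le> B"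
    using q(1) assms(1) by (auto simp: bcontfun_def bounded_iff)
  have "cmod (f x) \<le> B + 1" for x
    using B[of x] q(2)[rule_format, of x] norm_triangle_sub[of "f x" "q x"] by linarith
  then have "bounded (range f)" by (auto simp: bounded_iff)
  with cont show ?thesis by (simp add: bcontfun_def)
qed

lemma bcontfun_bounded:
  assumes "f \<in> bcontfun"
  obtains B where "B \<ge> 0" "\<And>x. norm (f x :: complex) \<le> B"
proof -
  obtain B where "\<forall>y\<in>range f. norm y \<le> B"
    using assms unfolding bcontfun_def bounded_iff by blast
  then have "norm (f x) \<le> max B 0" for x
    by (simp add: le_max_iff_disj)
  then show thesis using that[of "max B 0"] by simp
qed

lemma uniform_limit_mult_bounded:
  fixes f g :: "'a::topological_space \<Rightarrow> complex"
  assumes "uniform_limit UNIV p f F" "uniform_limit UNIV q g F" "f \<in> bcontfun" "g \<in> bcontfun"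
  shows "uniform_limit UNIV (\<lambda>n x. p n x * q n x) (\<lambda>x. f x * g x) F"
  using assms by (intro uniform_lim_mult) (auto simp: bcontfun_def)

text \<open>Since \<open>e\<^sub>l e\<^sub>m = e\<^sub>l\<^sub>+\<^sub>m\<close>, the trigonometric polynomials are already an algebra, and
  sums and products of bounded functions are compatible with uniform limits.\<close>

lemma closed_subalgebra_uniform_closure:
  "closed_subalgebra (uniform_closure (trig_polys UNIV :: (real ^ 'n \<Rightarrow> complex) set))"
  (is "closed_subalgebra ?C")
proof -
  have bc: "?C \<subseteq> bcontfun"
    using uniform_closure_bcontfun trig_polys_bcontfun by blast
  have lin: "(\<lambda>x. f x + g x) \<in> ?C" "(\<lambda>x. f x * g x) \<in> ?C" if f: "f \<in> ?C" and g: "g \<in> ?C" for f g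
  proof -
    obtain p where p: "\<And>n. p n \<in> trig_polys UNIV" "uniform_limit UNIV p f sequentially"
      by (rule uniform_closureE[OF f]) blast
    obtain q where q: "\<And>n. q n \<in> trig_polys UNIV" "uniform_limit UNIV q g sequentially"
      by (rule uniform_closureE[OF g]) blast
    show "(\<lambda>x. f x + g x) \<in> ?C"
      by (rule uniform_closureI[OF _ uniform_limit_add[OF p(2) q(2)]])
        (intro trig_polys_add p q)
    show "(\<lambda>x. f x * g x) \<in> ?C"
      by (rule uniform_closureI[OF _ uniform_limit_mult_bounded[OF p(2) q(2)]])
        (use f g bc p q in \<open>auto intro: trig_polys_mult\<close>)
  qed
  have lim: "f \<in> ?C" if F: "\<And>n. F n \<in> ?C" and Ff: "uniform_limit UNIV F f sequentially" for F f
    unfolding uniform_closure_def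
  proof clarify
    fix e :: real assume "e > 0"
    then obtain n where n: "\<forall>x. dist (F n x) (f x) < e/2"
      using Ff unfolding uniform_limit_sequentially_iff by (meson UNIV_I half_gt_zero order_refl)
    obtain p where p: "p \<in> trig_polys UNIV" "\<forall>x. cmod (F n x - p x) < e/2"
      using F[of n] half_gt_zero[OF \<open>e > 0\<close>] unfolding uniform_closure_def by blast
    have "cmod (f x - p x) < e" for x
    proof -
      have "cmod (f x - p x) \<le> cmod (f x - F n x) + cmod (F n x - p x)"
        using norm_triangle_ineq[of "f x - F n x" "F n x - p x"] by simp
      then show ?thesis using n[rule_format, of x] p(2)[rule_format, of x]
        by (simp add: dist_norm norm_minus_commute)
    qed
    with p(1) show "\<exists>p\<in>trig_polys UNIV. \<forall>x. cmod (f x - p x) < e" by blast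
  qed
  have const: "(\<lambda>x. c) \<in> ?C" for c
    unfolding uniform_closure_def using trig_polys_term[of c 0 UNIV]
    by (force intro!: bexI[of _ "\<lambda>x. c"])
  show ?thesis
    unfolding closed_subalgebra_def
  proof (intro conjI allI impI ballI)
    show "(\<lambda>x. c * f x) \<in> ?C" if "f \<in> ?C" for c f
      using lin(2)[OF const that] .
    show "f \<in> ?C" if "(\<forall>n. F n \<in> ?C) \<and> uniform_limit UNIV F f sequentially" for F f
      by (rule lim[of F]) (use that in auto)
  qed (use bc lin in auto)
qed

text \<open>This makes every almost periodic function accessible through uniform approximation by finite
  exponential sums, to which questions of convergence and identities reduce by continuity.\<close>

lemma AP_eq_uniform_closure:
  "(AP :: (real ^ 'n \<Rightarrow> complex) set) = uniform_closure (trig_polys UNIV)"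
  (is "_ = ?C")
proof
  have exps: "ap_exp l \<in> ?C" for l :: "real ^ 'n"
    unfolding uniform_closure_def using ap_exp_in_trig_polys[of l UNIV]
    by (force intro!: bexI[of _ "ap_exp l"])
  show "AP \<subseteq> ?C"
    unfolding AP_def
    by (intro hull_minimal closed_subalgebra_uniform_closure) (use exps in auto)
  show "?C \<subseteq> AP"
    unfolding AP_def hull_def
  proof (intro subsetI InterI)
    fix f and A :: "(real ^ 'n \<Rightarrow> complex) set" assume f: "f \<in> ?C" and "A \<in> {t. closed_subalgebra t \<and> range ap_exp \<subseteq> t}"
    then have A: "closed_subalgebra A" and e: "\<And>l. ap_exp l \<in> A" by auto
    have add: "\<And>f g. f \<in> A \<Longrightarrow> g \<in> A \<Longrightarrow> (\<lambda>x. f x + g x) \<in> A"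
      and cmult: "\<And>c f. f \<in> A \<Longrightarrow> (\<lambda>x. c * f x) \<in> A"
      using A unfolding closed_subalgebra_def by blast+
    have *: "trig_sum F c \<in> A" if "finite F" for F and c :: "real ^ 'n \<Rightarrow> complex"
      using that
    proof (induction F)
      case empty
      \<comment> \<open>The zero function is reached as a multiple of an exponential.\<close>
      have "(\<lambda>x. 0 * ap_exp 0 x) \<in> A"
        by (rule cmult[OF e])
      then show ?case by (simp add: trig_sum_def)
    next
      case (insert l F)
      have "(\<lambda>x. c l * ap_exp l x) \<in> A"
        by (rule cmult[OF e])
      from add[OF this insert.IH] have "(\<lambda>x. c l * ap_exp l x + trig_sum F c x) \<in> A" .
      with insert.hyps show ?case by (simp add: trig_sum_def)
    qed
    obtain p where p: "\<And>n. p n \<in> trig_polys UNIV" "uniform_limit UNIV p f sequentially"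
      by (rule uniform_closureE[OF f]) blast
    have "p n \<in> A" for n
      using p(1)[of n] * by (auto simp: trig_polys_def)
    with p(2) A show "f \<in> A"
      unfolding closed_subalgebra_def by blast
  qed
qed

lemma closed_subalgebra_AP: "closed_subalgebra AP"
  unfolding AP_eq_uniform_closure by (rule closed_subalgebra_uniform_closure)

lemma
  shows AP_bcontfun: "f \<in> AP \<Longrightarrow> f \<in> bcontfun"
    and AP_add: "f \<in> AP \<Longrightarrow> g \<in> AP \<Longrightarrow> (\<lambda>x. f x + g x) \<in> AP"
    and AP_cmult: "f \<in> AP \<Longrightarrow> (\<lambda>x. c * f x) \<in> AP"
    and AP_mult: "f \<in> AP \<Longrightarrow> g \<in> AP \<Longrightarrow> (\<lambda>x. f x * g x) \<in> AP"
    and AP_uniform_limit: "(\<And>n. F n \<in> AP) \<Longrightarrow> uniform_limit UNIV F f sequentially \<Longrightarrow> f \<in> AP"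
  using closed_subalgebra_AP unfolding closed_subalgebra_def by blast+

lemma AP_diff: "f \<in> AP \<Longrightarrow> g \<in> AP \<Longrightarrow> (\<lambda>x. f x - g x) \<in> AP"
  using AP_add[OF _ AP_cmult[of g "-1"], of f] by simp

lemma trig_polys_AP: "p \<in> trig_polys D \<Longrightarrow> p \<in> AP"
  unfolding AP_eq_uniform_closure trig_polys_def uniform_closure_def by force

lemma trig_sum_AP: "finite F \<Longrightarrow> trig_sum F c \<in> AP"
  using trig_polys_AP[OF trig_sum_in[of F UNIV]] by simp

lemma ap_exp_AP: "ap_exp l \<in> AP"
  by (rule trig_polys_AP[OF ap_exp_in_trig_polys[of l UNIV]]) simp

lemma AP_continuous_on: "f \<in> AP \<Longrightarrow> continuous_on S f"
  using AP_bcontfun[of f] continuous_on_subset[of UNIV f S] by (simp add: bcontfun_def)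

lemma AP_approx:
  assumes "f \<in> AP"
  obtains p where "\<And>n. p n \<in> trig_polys UNIV" "uniform_limit UNIV p f sequentially"
  using assms uniform_closureE unfolding AP_eq_uniform_closure by blast

section \<open>Bohr means and Bohr--Fourier coefficients\<close>

definition cube :: "real \<Rightarrow> (real ^ 'n) set" where
  "cube T = cbox (\<chi> i. - T) (\<chi> i. T)"

definition cube_mean :: "real \<Rightarrow> (real ^ 'n \<Rightarrow> complex) \<Rightarrow> complex" where
  "cube_mean T f = of_real (1 / (2 * T) ^ CARD('n)) * integral (cube T) f"

lemma measure_cube: "T \<ge> 0 \<Longrightarrow> measure lborel (cube T :: (real ^ 'n) set) = (2 * T) ^ CARD('n)"
  unfolding cube_def by (subst content_cbox_cart) (auto simp: interval_ne_empty_cart)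

lemma integrable_on_cube: "continuous_on UNIV f \<Longrightarrow> (f :: _ \<Rightarrow> complex) integrable_on (cube T)"
  unfolding cube_def by (rule integrable_continuous) (rule continuous_on_subset, auto)

lemma norm_cube_mean_le:
  assumes "T > 0" "continuous_on UNIV f" "\<And>x. cmod (f x) \<le> B"
  shows "cmod (cube_mean T (f :: real ^ 'n \<Rightarrow> complex)) \<le> B"
proof -
  have "cmod (integral (cube T) f) \<le> integral (cube T) (\<lambda>x :: real ^ 'n. B)"
    by (rule integral_norm_bound_integral[OF integrable_on_cube[OF assms(2)]])
      (use assms(3) in \<open>auto simp: cube_def\<close>)
  also have "\<dots> = B * (2 * T) ^ CARD('n)"
    using measure_cube[of T, where 'n = 'n] assms(1) unfolding cube_def by simp
  finally show ?thesis
    using assms(1) by (simp add: cube_mean_def norm_mult norm_divide norm_power field_simps)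
qed

lemma cube_mean_add:
  assumes "continuous_on UNIV f" "continuous_on UNIV g"
  shows "cube_mean T (\<lambda>x. f x + g x) = cube_mean T f + cube_mean T g"
  unfolding cube_mean_def
  by (simp add: integral_add[OF integrable_on_cube[OF assms(1)] integrable_on_cube[OF assms(2)]] distrib_left)

lemma cube_mean_cmult: "cube_mean T (\<lambda>x. c * f x) = c * cube_mean T f"
  unfolding cube_mean_def by simp

lemma cube_mean_diff:
  assumes "continuous_on UNIV f" "continuous_on UNIV g"
  shows "cube_mean T (\<lambda>x. f x - g x) = cube_mean T f - cube_mean T g"
  using cube_mean_add[OF assms(1), of "\<lambda>x. -1 * g x" T] cube_mean_cmult[of T "-1" g] assms
  by (simp add: continuous_on_minus)

lemma norm_integral_diff_subbox_le:
  fixes f :: "'a::euclidean_space \<Rightarrow> complex"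
  assumes sub: "cbox c d \<subseteq> cbox a b" and f: "continuous_on UNIV f" "\<And>x. cmod (f x) \<le> 1"
  shows "cmod (integral (cbox a b) f - integral (cbox c d) f) \<le> measure lborel (cbox a b) - measure lborel (cbox c d)"
proof -
  have int: "f integrable_on cbox u v" for u v
    by (rule integrable_continuous) (rule continuous_on_subset[OF f(1)], auto)
  have h1: "((\<lambda>x. if x \<in> cbox c d then f x else 0) has_integral integral (cbox c d) f) (cbox a b)"
    unfolding has_integral_restrict[OF sub] by (rule integrable_integral[OF int])
  have h2: "((\<lambda>x. if x \<in> cbox c d then 1 else 0 :: real) has_integral measure lborel (cbox c d)) (cbox a b)"
    unfolding has_integral_restrict[OF sub] using has_integral_const[of "1::real" c d] by simp
  note i1 = has_integral_integrable[OF h1] and i2 = has_integral_integrable[OF h2]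
    and r1 = integral_unique[OF h1] and r2 = integral_unique[OF h2]
  have "cmod (integral (cbox a b) (\<lambda>x. f x - (if x \<in> cbox c d then f x else 0)))
      \<le> integral (cbox a b) (\<lambda>x. 1 - (if x \<in> cbox c d then 1 else 0))"
    by (rule integral_norm_bound_integral) (use f i1 i2 int in \<open>auto intro!: integrable_diff\<close>)
  then show ?thesis
    using integral_diff[OF integrable_const[of "1::real" a b] i2] integral_diff[OF int i1] r1 r2
    by simp
qed

text \<open>For \<open>l \<noteq> 0\<close> choose a translation \<open>h\<close> with \<open>l \<bullet> h = \<pi>\<close>. It changes the sign of the
  exponential, while a large cube and its translate differ only by a set of relatively small
  volume. The mean over the cube is thus almost equal to its own negative.\<close>

lemma tendsto_cube_mean_ap_exp:
  fixes l :: "real ^ 'n"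
  shows "((\<lambda>T. cube_mean T (ap_exp l)) \<longlongrightarrow> (if l = 0 then 1 else 0)) at_top"
proof (cases "l = 0")
  case True
  have "eventually (\<lambda>T. 1 = cube_mean T (ap_exp l)) at_top"
    using eventually_gt_at_top[of 0]
  proof eventually_elim
    case (elim T)
    then show ?case
      using measure_cube[of T, where 'n = 'n] True
      by (simp add: cube_mean_def cube_def scaleR_conv_of_real power_mult_distrib field_simps)
  qed
  with True show ?thesis
    using tendsto_cong[of "\<lambda>T. 1" "\<lambda>T. cube_mean T (ap_exp l)" at_top] by (simp add: tendsto_eventually eventually_mono)
next
  case False
  define h where "h = (pi / (l \<bullet> l)) *\<^sub>R l"
  define m where "m = norm h"
  have lh: "l \<bullet> h = pi" using False by (simp add: h_def)
  have hi: "\<bar>h $ i\<bar> \<le> m" for i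
    unfolding m_def by (rule component_le_norm_cart)
  have bound: "cmod (cube_mean T (ap_exp l)) \<le> 1 - ((T - m) / T) ^ CARD('n)" if T: "T > m" "T > 0" for T
  proof -
    let ?a = "(\<chi> i. - T) :: real ^ 'n" and ?b = "(\<chi> i. T) :: real ^ 'n"
    \<comment> \<open>A concentric cube that lies both in the cube of half side \<open>T\<close> and in its translate by \<open>h\<close>.\<close>
    let ?C = "cube (T - m) :: (real ^ 'n) set"
    have C: "?C \<subseteq> cbox ?a ?b" "?C \<subseteq> cbox (?a + h) (?b + h)"
      using hi by (auto simp: cube_def mem_box_cart abs_le_iff) (smt (verit))+
    have sh: "measure lborel (cbox (?a + h) (?b + h)) = measure lborel (cbox ?a ?b)"
      by (subst (1 2) content_cbox_cart) (use T in \<open>auto simp: interval_ne_empty_cart\<close>)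
    have cont: "measure lborel (cbox ?a ?b) = (2 * T) ^ CARD('n)" "measure lborel ?C = (2 * (T - m)) ^ CARD('n)"
      using measure_cube[of T, where 'n='n] measure_cube[of "T - m", where 'n='n] T by (auto simp: cube_def)
    have "ap_exp l \<circ> (+) h = (\<lambda>x. - ap_exp l x)"
      by (rule ext) (simp add: ap_exp_shift o_def, simp add: ap_exp_def lh)
    then have J: "integral (cbox (?a + h) (?b + h)) (ap_exp l) = - integral (cbox ?a ?b) (ap_exp l)"
      using integral_shift_cbox_plus[of ?a ?b "ap_exp l" h] by simp
    have 1: "cmod (integral (cbox ?a ?b) (ap_exp l) - integral ?C (ap_exp l)) \<le> measure lborel (cbox ?a ?b) - measure lborel ?C"
      using C(1) unfolding cube_def by (rule norm_integral_diff_subbox_le) (auto intro: continuous_intros)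
    have 2: "cmod (integral (cbox (?a+h) (?b+h)) (ap_exp l) - integral ?C (ap_exp l)) \<le> measure lborel (cbox ?a ?b) - measure lborel ?C"
      unfolding sh[symmetric]
      using C(2) unfolding cube_def by (rule norm_integral_diff_subbox_le) (auto intro: continuous_intros)
    have "cmod (2 * integral (cbox ?a ?b) (ap_exp l)) \<le> 2 * (measure lborel (cbox ?a ?b) - measure lborel ?C)"
      using norm_triangle_ineq4[of "integral (cbox ?a ?b) (ap_exp l) - integral ?C (ap_exp l)"
        "integral (cbox (?a+h) (?b+h)) (ap_exp l) - integral ?C (ap_exp l)"] 1 2
      unfolding J by simp
    then have "cmod (integral (cube T) (ap_exp l)) \<le> 2 ^ CARD('n) * T ^ CARD('n) - 2 ^ CARD('n) * (T - m) ^ CARD('n)"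
      unfolding cont power_mult_distrib by (simp add: norm_mult cube_def)
    then show ?thesis
      using T by (simp add: cube_mean_def norm_mult norm_divide norm_power field_simps power_mult_distrib)
  qed
  have "((\<lambda>T::real. 1 - (1 - m / T) ^ CARD('n)) \<longlongrightarrow> 1 - (1 - 0) ^ CARD('n)) at_top"
    by (intro tendsto_intros tendsto_divide_0[OF tendsto_const] filterlim_at_top_imp_at_infinity filterlim_ident)
  then have "((\<lambda>T::real. 1 - (1 - m / T) ^ CARD('n)) \<longlongrightarrow> 0) at_top"
    by simp
  then have "((\<lambda>T::real. 1 - ((T - m) / T) ^ CARD('n)) \<longlongrightarrow> 0) at_top"
  proof (rule Lim_transform_eventually)
    show "eventually (\<lambda>T. 1 - (1 - m / T) ^ CARD('n) = 1 - ((T - m) / T) ^ CARD('n)) at_top"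
      using eventually_gt_at_top[of 0] by eventually_elim (simp add: diff_divide_distrib)
  qed
  then have "((\<lambda>T. cube_mean T (ap_exp l)) \<longlongrightarrow> 0) at_top"
    using Lim_null_comparison[of "\<lambda>T. cube_mean T (ap_exp l)" "\<lambda>T. 1 - ((T - m) / T) ^ CARD('n)" at_top]
    eventually_gt_at_top[of "max m 0"] bound by (simp add: eventually_mono)
  with False show ?thesis by simp
qed

lemma tendsto_cube_mean_trig_poly:
  assumes "p \<in> trig_polys D"
  shows "\<exists>L. ((\<lambda>T. cube_mean T p) \<longlongrightarrow> L) at_top"
proof -
  obtain F c where F: "finite F" "p = trig_sum F c"
    using assms by (auto simp: trig_polys_def)
  have "\<exists>L. ((\<lambda>T. cube_mean T (trig_sum F c)) \<longlongrightarrow> L) at_top"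
    using F(1)
  proof (induction F)
    case empty
    then show ?case by (auto simp: trig_sum_def cube_mean_def)
  next
    case (insert l F)
    have "trig_sum (insert l F) c = (\<lambda>x. c l * ap_exp l x + trig_sum F c x)"
      using insert by (simp add: trig_sum_def)
    moreover have "continuous_on UNIV (\<lambda>x. c l * ap_exp l x)" "continuous_on UNIV (trig_sum F c)"
      by (auto simp: trig_sum_def intro!: continuous_intros)
    ultimately have eq: "cube_mean T (trig_sum (insert l F) c)
        = c l * cube_mean T (ap_exp l) + cube_mean T (trig_sum F c)" for T
      by (simp add: cube_mean_add cube_mean_cmult)
    show ?case
      unfolding eq using insert.IH tendsto_cube_mean_ap_exp[of l]
      by (metis tendsto_add tendsto_mult_left)
  qed
  then show ?thesis by (simp add: F)
qed

text \<open>Means over cubes are contractions for the supremum norm, uniformly in the size of the cube. Hence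
  uniform approximation of \<open>f\<close> by polynomials is uniform approximation of their means, and the two
  limits can be interchanged.\<close>

lemma convergent_cube_mean_AP:
  fixes f :: "real ^ 'n \<Rightarrow> complex"
  assumes "f \<in> AP"
  obtains L where "((\<lambda>T. cube_mean T f) \<longlongrightarrow> L) at_top"
proof -
  obtain p where p: "\<And>n. p n \<in> trig_polys UNIV" "uniform_limit UNIV p f sequentially"
    using AP_approx[OF assms] by blast
  obtain L where L: "\<And>n. ((\<lambda>T. cube_mean T (p n)) \<longlongrightarrow> L n) at_top"
    using tendsto_cube_mean_trig_poly[OF p(1)] by metis
  have cont: "continuous_on UNIV (p n)" for n
    using p(1) trig_polys_AP AP_continuous_on by blast
  have unif: "uniform_limit {0<..} (\<lambda>n T. cube_mean T (p n)) (\<lambda>T. cube_mean T f) sequentially"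
    unfolding uniform_limit_sequentially_iff
  proof (intro allI impI)
    fix e :: real assume "e > 0"
    then obtain N where N: "\<And>n x. n \<ge> N \<Longrightarrow> dist (p n x) (f x) < e/2"
      using p(2) unfolding uniform_limit_sequentially_iff by (metis UNIV_I half_gt_zero)
    have "dist (cube_mean T (p n)) (cube_mean T f) < e" if "n \<ge> N" "T > 0" for n T
    proof -
      have "cmod (cube_mean T (\<lambda>x. p n x - f x)) \<le> e/2"
        using that N[OF that(1)]
        by (intro norm_cube_mean_le continuous_on_diff cont AP_continuous_on assms)
          (auto simp: dist_norm intro: less_imp_le)
      then show ?thesis
        using \<open>e > 0\<close> by (simp add: cube_mean_diff[OF cont AP_continuous_on[OF assms]] dist_norm)
    qed
    then show "\<exists>N. \<forall>n\<ge>N. \<forall>T\<in>{0<..}. dist (cube_mean T (p n)) (cube_mean T f) < e" by auto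
  qed
  have "Cauchy L"
  proof (rule metric_CauchyI)
    fix e :: real assume "e > 0"
    then obtain N where N: "\<And>n T. n \<ge> N \<Longrightarrow> T > 0 \<Longrightarrow> dist (cube_mean T (p n)) (cube_mean T f) < e/4"
      using unif unfolding uniform_limit_sequentially_iff
      by (metis divide_pos_pos greaterThan_iff zero_less_numeral)
    have "dist (L n) (L k) < e" if "n \<ge> N" "k \<ge> N" for n k
    proof -
      have "dist (L n) (L k) \<le> e/2"
      proof (rule tendsto_upperbound[OF tendsto_dist[OF L L]])
        show "eventually (\<lambda>T. dist (cube_mean T (p n)) (cube_mean T (p k)) \<le> e/2) at_top"
          using eventually_gt_at_top[of 0]
        proof eventually_elim
          case (elim T)
          then show ?case
            using N[OF that(1) elim] N[OF that(2) elim]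
              dist_triangle2[of "cube_mean T (p n)" "cube_mean T (p k)" "cube_mean T f"] by linarith
        qed
      qed auto
      then show ?thesis using \<open>e > 0\<close> by linarith
    qed
    then show "\<exists>N. \<forall>n\<ge>N. \<forall>k\<ge>N. dist (L n) (L k) < e" by blast
  qed
  then obtain l where l: "L \<longlonglongrightarrow> l"
    using Cauchy_convergent_iff convergent_def by blast
  have "((\<lambda>T. cube_mean T f) \<longlongrightarrow> l) at_top"
    by (rule swap_uniform_limit'[OF _ l unif]) (auto simp: L eventually_gt_at_top)
  then show thesis by (rule that)
qed

lemma bohr_coeff_eq_Lim: "bohr_coeff f l = Lim at_top (\<lambda>T. cube_mean T (\<lambda>x. ap_exp (- l) x * f x))"
  unfolding bohr_coeff_def cube_mean_def cube_def ap_exp_def by simp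

lemma tendsto_bohr_coeff:
  assumes "f \<in> AP"
  shows "((\<lambda>T. cube_mean T (\<lambda>x. ap_exp (- l) x * f x)) \<longlongrightarrow> bohr_coeff f l) at_top"
proof -
  obtain L where "((\<lambda>T. cube_mean T (\<lambda>x. ap_exp (- l) x * f x)) \<longlongrightarrow> L) at_top"
    using convergent_cube_mean_AP[OF AP_mult[OF ap_exp_AP assms]] by blast
  then show ?thesis
    unfolding bohr_coeff_eq_Lim by (simp add: tendsto_Lim)
qed

lemma bohr_coeff_unique:
  assumes "((\<lambda>T. cube_mean T (\<lambda>x. ap_exp (- l) x * f x)) \<longlongrightarrow> L) at_top"
  shows "bohr_coeff f l = L"
  unfolding bohr_coeff_eq_Lim using assms by (simp add: tendsto_Lim)

lemma norm_bohr_coeff_le: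
  assumes "f \<in> AP" "\<And>x. cmod (f x) \<le> B"
  shows "cmod (bohr_coeff f l) \<le> B"
proof (rule tendsto_upperbound[OF tendsto_norm[OF tendsto_bohr_coeff[OF assms(1)]]])
  show "eventually (\<lambda>T. cmod (cube_mean T (\<lambda>x. ap_exp (- l) x * f x)) \<le> B) at_top"
    using eventually_gt_at_top[of 0]
    by eventually_elim (intro norm_cube_mean_le continuous_intros AP_continuous_on assms,
        auto simp: norm_mult assms)
qed simp

lemma bohr_coeff_add:
  assumes "f \<in> AP" "g \<in> AP"
  shows "bohr_coeff (\<lambda>x. f x + g x) l = bohr_coeff f l + bohr_coeff g l"
proof (rule bohr_coeff_unique)
  have "cube_mean T (\<lambda>x. ap_exp (- l) x * (f x + g x))
      = cube_mean T (\<lambda>x. ap_exp (- l) x * f x) + cube_mean T (\<lambda>x. ap_exp (- l) x * g x)" for T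
    unfolding distrib_left by (intro cube_mean_add continuous_intros AP_continuous_on assms)
  then show "((\<lambda>T. cube_mean T (\<lambda>x. ap_exp (- l) x * (f x + g x)))
      \<longlongrightarrow> bohr_coeff f l + bohr_coeff g l) at_top"
    using tendsto_add[OF assms[THEN tendsto_bohr_coeff]] by simp
qed

lemma bohr_coeff_cmult:
  assumes "f \<in> AP"
  shows "bohr_coeff (\<lambda>x. c * f x) l = c * bohr_coeff f l"
proof (rule bohr_coeff_unique)
  have "cube_mean T (\<lambda>x. ap_exp (- l) x * (c * f x)) = c * cube_mean T (\<lambda>x. ap_exp (- l) x * f x)" for T
    using cube_mean_cmult[of T c "\<lambda>x. ap_exp (- l) x * f x"] by (simp add: mult_ac)
  then show "((\<lambda>T. cube_mean T (\<lambda>x. ap_exp (- l) x * (c * f x))) \<longlongrightarrow> c * bohr_coeff f l) at_top"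
    using tendsto_mult_left[OF tendsto_bohr_coeff[OF assms]] by simp
qed

lemma bohr_coeff_diff:
  assumes "f \<in> AP" "g \<in> AP"
  shows "bohr_coeff (\<lambda>x. f x - g x) l = bohr_coeff f l - bohr_coeff g l"
  using bohr_coeff_add[OF assms(1) AP_cmult[OF assms(2)], of "-1" l] bohr_coeff_cmult[OF assms(2), of "-1" l]
  by simp

lemma bohr_coeff_zero: "bohr_coeff (\<lambda>x. 0) l = 0"
  using bohr_coeff_cmult[OF ap_exp_AP, of 0] by simp

lemma bohr_coeff_ap_exp_mult:
  "bohr_coeff (\<lambda>x. ap_exp m x * f x) l = bohr_coeff f (l - m)"
proof -
  have "ap_exp (- l) x * (ap_exp m x * f x) = ap_exp (- (l - m)) x * f x" for x
    using ap_exp_add[of "- l" m x] by (simp flip: mult.assoc)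
  then show ?thesis unfolding bohr_coeff_eq_Lim by (simp only:)
qed

lemma bohr_coeff_ap_exp: "bohr_coeff (ap_exp m) l = (if l = m then 1 else 0)"
proof (rule bohr_coeff_unique)
  have "ap_exp (- l) x * ap_exp m x = ap_exp (m - l) x" for x
    using ap_exp_add[of "- l" m x] by simp
  then show "((\<lambda>T. cube_mean T (\<lambda>x. ap_exp (- l) x * ap_exp m x)) \<longlongrightarrow> (if l = m then 1 else 0)) at_top"
    using tendsto_cube_mean_ap_exp[of "m - l"] by (auto split: if_splits)
qed

lemma AP_sum: "(\<And>i. i \<in> I \<Longrightarrow> p i \<in> AP) \<Longrightarrow> (\<lambda>x. \<Sum>i\<in>I. p i x) \<in> AP"
  by (induction I rule: infinite_finite_induct)
    (auto intro: AP_add trig_polys_AP[OF zero_in_trig_polys])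

lemma bohr_coeff_sum:
  "(\<And>i. i \<in> I \<Longrightarrow> p i \<in> AP) \<Longrightarrow> bohr_coeff (\<lambda>x. \<Sum>i\<in>I. p i x) l = (\<Sum>i\<in>I. bohr_coeff (p i) l)"
  by (induction I rule: infinite_finite_induct) (auto simp: bohr_coeff_zero bohr_coeff_add AP_sum)

lemma bohr_coeff_trig_sum:
  assumes "finite F"
  shows "bohr_coeff (trig_sum F c) l = (if l \<in> F then c l else 0)"
proof -
  have "bohr_coeff (trig_sum F c) l = (\<Sum>m\<in>F. c m * (if l = m then 1 else 0))"
    unfolding trig_sum_def
    by (simp add: bohr_coeff_sum AP_cmult ap_exp_AP bohr_coeff_cmult bohr_coeff_ap_exp)
  also have "\<dots> = (if l \<in> F then c l else 0)"
    using assms by (simp add: if_distrib sum.delta cong: if_cong)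
  finally show ?thesis .
qed

lemma tendsto_bohr_coeff_uniform_limit:
  assumes "\<And>n. p n \<in> AP" "f \<in> AP" "uniform_limit UNIV p f sequentially"
  shows "(\<lambda>n. bohr_coeff (p n) l) \<longlonglongrightarrow> bohr_coeff f l"
proof (rule metric_LIMSEQ_I)
  fix e :: real assume "e > 0"
  then obtain N where N: "\<And>n x. n \<ge> N \<Longrightarrow> dist (p n x) (f x) < e/2"
    using assms(3) unfolding uniform_limit_sequentially_iff by (metis UNIV_I half_gt_zero)
  have "dist (bohr_coeff (p n) l) (bohr_coeff f l) < e" if "n \<ge> N" for n
  proof -
    have "cmod (bohr_coeff (\<lambda>x. p n x - f x) l) \<le> e/2"
      using N[OF that]
      by (intro norm_bohr_coeff_le AP_diff assms) (auto simp: dist_norm intro: less_imp_le)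
    then show ?thesis
      using \<open>e > 0\<close> by (simp add: bohr_coeff_diff assms dist_norm)
  qed
  then show "\<exists>N. \<forall>n\<ge>N. dist (bohr_coeff (p n) l) (bohr_coeff f l) < e" by blast
qed

section \<open>Bochner--Fejer approximation\<close>

text \<open>Allowing a set \<open>F\<close> larger than the spectrum lets several polynomials be written over the same
  index set.\<close>

lemma trig_polys_eq_trig_sum:
  assumes "finite F" "p \<in> trig_polys D" "bohr_spectrum p \<subseteq> F"
  shows "p = trig_sum F (bohr_coeff p)"
proof -
  obtain G c where G: "finite G" "p = trig_sum G c"
    using assms(2) by (auto simp: trig_polys_def)
  have c: "bohr_coeff p l = (if l \<in> G then c l else 0)" for l
    by (simp add: G bohr_coeff_trig_sum)
  have "p = trig_sum (F \<union> G) (\<lambda>l. if l \<in> G then c l else 0)"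
    unfolding G(2) using assms(1) G(1) by (intro trig_sum_extend) auto
  also have "(\<lambda>l. if l \<in> G then c l else 0) = bohr_coeff p"
    using c by auto
  finally have "p = trig_sum (F \<union> G) (bohr_coeff p)" .
  also have "\<dots> = trig_sum F (bohr_coeff p)"
    unfolding trig_sum_def using assms G
    by (intro ext sum.mono_neutral_right) (auto simp: bohr_spectrum_def)
  finally show ?thesis .
qed

lemma finite_bohr_spectrum_trig_poly:
  assumes "p \<in> trig_polys D"
  shows "finite (bohr_spectrum p)" "bohr_spectrum p \<subseteq> D"
proof -
  obtain F c where F: "finite F" "F \<subseteq> D" "p = trig_sum F c"
    using assms by (auto simp: trig_polys_def)
  have "bohr_spectrum p \<subseteq> F"
    by (auto simp: bohr_spectrum_def F bohr_coeff_trig_sum split: if_splits)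
  with F show "finite (bohr_spectrum p)" "bohr_spectrum p \<subseteq> D"
    using finite_subset by auto
qed

text \<open>The coefficient at 0 is the Bohr mean, a positive functional. This is why averaging against a
  nonnegative kernel of mean 1 is a contraction.\<close>

lemma norm_bohr_coeff_0_le:
  fixes g k :: "real ^ 'n \<Rightarrow> complex"
  assumes "g \<in> AP" "k \<in> AP" "\<And>x. cmod (g x) \<le> Re (k x)"
  shows "cmod (bohr_coeff g 0) \<le> Re (bohr_coeff k 0)"
proof -
  have t: "((\<lambda>T. cube_mean T f) \<longlongrightarrow> bohr_coeff f 0) at_top" if "f \<in> AP" for f
    using tendsto_bohr_coeff[OF that, of 0] by simp
  have "eventually (\<lambda>T. cmod (cube_mean T g) \<le> Re (cube_mean T k)) at_top"
    using eventually_gt_at_top[of 0]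
  proof eventually_elim
    case (elim T)
    note ig = integrable_on_cube[OF AP_continuous_on[OF assms(1)], of T]
    note ik = integrable_on_cube[OF AP_continuous_on[OF assms(2)], of T]
    have "cmod (integral (cube T) g) \<le> integral (cube T) (\<lambda>x. Re (k x))"
      using integrable_linear[OF ik bounded_linear_Re] assms(3)
      by (intro integral_norm_bound_integral ig) (auto simp: o_def)
    also have "\<dots> = Re (integral (cube T) k)"
      using integral_linear[OF ik bounded_linear_Re] by (simp add: o_def)
    finally have "(1 / (2 * T) ^ CARD('n)) * cmod (integral (cube T) g)
        \<le> (1 / (2 * T) ^ CARD('n)) * Re (integral (cube T) k)"
      using elim by (intro mult_left_mono) auto
    moreover have "0 \<le> 1 / (2 * T) ^ CARD('n)" using elim by simp
    ultimately show ?case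
      unfolding cube_mean_def norm_mult norm_of_real by simp
  qed
  then show ?thesis
    by (intro tendsto_le[OF _ tendsto_Re[OF t[OF assms(2)]] tendsto_norm[OF t[OF assms(1)]]]) auto
qed

text \<open>The Bohr convolution of \<open>f\<close> with the nonnegative kernel \<open>|\<Sum>\<^sub>a e\<^sub>a|\<^sup>2 / |A|\<close>,
  with the square multiplied out.\<close>

definition fejer :: "(real ^ 'n) set \<Rightarrow> (real ^ 'n \<Rightarrow> complex) \<Rightarrow> real ^ 'n \<Rightarrow> complex" where
  "fejer A f = (\<lambda>x. of_real (1 / card A) * (\<Sum>a\<in>A. \<Sum>b\<in>A. bohr_coeff f (a - b) * ap_exp (a - b) x))"

text \<open>Measures how close \<open>A\<close> is to being invariant under translation by \<open>l\<close>; it is the Fourier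
  coefficient at \<open>l\<close> of the kernel in \<^term>\<open>fejer A\<close>.\<close>

definition fejer_weight :: "(real ^ 'n) set \<Rightarrow> real ^ 'n \<Rightarrow> real" where
  "fejer_weight A l = card {b \<in> A. l + b \<in> A} / card A"

lemma fejer_in_trig_polys: "fejer A f \<in> trig_polys (bohr_spectrum f)"
  unfolding fejer_def
  by (intro trig_polys_cmult trig_polys_sum trig_polys_term) (auto simp: bohr_spectrum_def)

lemma bohr_coeff_fejer:
  assumes "finite A"
  shows "bohr_coeff (fejer A f) l = of_real (fejer_weight A l) * bohr_coeff f l"
proof -
  have "bohr_coeff (fejer A f) l
      = of_real (1 / card A) * (\<Sum>a\<in>A. \<Sum>b\<in>A. bohr_coeff f (a - b) * (if l = a - b then 1 else 0))"
    unfolding fejer_def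
    by (simp add: bohr_coeff_cmult bohr_coeff_sum AP_sum AP_cmult ap_exp_AP bohr_coeff_ap_exp del: of_real_divide)
  also have "(\<Sum>a\<in>A. \<Sum>b\<in>A. bohr_coeff f (a - b) * (if l = a - b then 1 else 0))
      = (\<Sum>b\<in>A. \<Sum>a\<in>A. if a = l + b then bohr_coeff f l else 0)"
    by (subst sum.swap) (auto intro!: sum.cong)
  also have "\<dots> = (\<Sum>b\<in>A. if l + b \<in> A then bohr_coeff f l else 0)"
    using assms by simp
  also have "\<dots> = of_nat (card {b \<in> A. l + b \<in> A}) * bohr_coeff f l"
    using assms by (simp flip: sum.inter_filter)
  finally show ?thesis by (simp add: fejer_weight_def)
qed

lemma fejer_weight_bounds: "finite A \<Longrightarrow> 0 \<le> fejer_weight A l" "finite A \<Longrightarrow> fejer_weight A l \<le> 1"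
  by (auto simp: fejer_weight_def divide_simps intro!: card_mono)

lemma fejer_diff:
  assumes "f \<in> AP" "g \<in> AP"
  shows "fejer A (\<lambda>x. f x - g x) x = fejer A f x - fejer A g x"
  by (simp add: fejer_def bohr_coeff_diff assms left_diff_distrib sum_subtractf diff_divide_distrib)

text \<open>\<open>fejer A f x\<close> is the Bohr mean of \<open>f\<close> against the kernel \<open>k / |A|\<close>, where
  \<open>k s = |\<Sum>\<^sub>a e\<^sub>a (x - s)|\<^sup>2\<close> is nonnegative. Taking \<open>f = 1\<close> in the same formula shows
  that the kernel has mean 1.\<close>

lemma norm_fejer_le:
  fixes f :: "real ^ 'n \<Rightarrow> complex"
  assumes f: "f \<in> AP" "\<And>x. cmod (f x) \<le> B" and A: "finite A" "A \<noteq> {}"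
  shows "cmod (fejer A f x) \<le> B"
proof -
  define k where "k = (\<lambda>s. \<Sum>a\<in>A. \<Sum>b\<in>A. ap_exp (a - b) x * ap_exp (- (a - b)) s)"
  have k_sq: "k s = of_real ((cmod (\<Sum>a\<in>A. ap_exp a (x - s)))\<^sup>2)" for s
  proof -
    have "ap_exp (a - b) x * ap_exp (- (a - b)) s = ap_exp a (x - s) * cnj (ap_exp b (x - s))" for a b
      using ap_exp_add[of a "- b" "x - s"] ap_exp_diff_arg[of "a - b" x s] by (simp add: cnj_ap_exp)
    then show ?thesis
      by (simp add: k_def complex_norm_square sum_product del: of_real_power)
  qed
  have mean: "bohr_coeff (\<lambda>s. g s * k s) 0 = of_nat (card A) * fejer A g x"
    and AP: "(\<lambda>s. g s * k s) \<in> AP" if g: "g \<in> AP" for g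
  proof -
    have eq: "(\<lambda>s. g s * k s) = (\<lambda>s. \<Sum>a\<in>A. \<Sum>b\<in>A. ap_exp (a - b) x * (ap_exp (- (a - b)) s * g s))"
      by (simp add: k_def sum_distrib_left mult_ac)
    have AP1: "(\<lambda>s. ap_exp l s * g s) \<in> AP" for l
      using AP_mult[OF ap_exp_AP g] .
    show "(\<lambda>s. g s * k s) \<in> AP"
      unfolding eq by (intro AP_sum AP_cmult AP1)
    have "bohr_coeff (\<lambda>s. g s * k s) 0 = (\<Sum>a\<in>A. \<Sum>b\<in>A. ap_exp (a - b) x * bohr_coeff g (a - b))"
      unfolding eq by (simp add: bohr_coeff_sum AP_sum AP_cmult AP1 bohr_coeff_cmult bohr_coeff_ap_exp_mult
          del: minus_diff_eq)
    also have "\<dots> = of_nat (card A) * fejer A g x"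
      using A by (simp add: fejer_def mult.commute)
    finally show "bohr_coeff (\<lambda>s. g s * k s) 0 = of_nat (card A) * fejer A g x" .
  qed
  have one: "(\<lambda>s. 1) \<in> AP" using ap_exp_AP[of 0] by simp
  have kAP: "k \<in> AP" using AP[OF one] by simp
  have "bohr_coeff (\<lambda>s. 1) l = (if l = 0 then 1 else 0)" for l :: "real ^ 'n"
    using bohr_coeff_ap_exp[of 0 l] by simp
  then have "fejer A (\<lambda>s. 1) x = of_real (1 / card A) * (\<Sum>a\<in>A. \<Sum>b\<in>A. if b = a then 1 else 0)"
    unfolding fejer_def by (intro arg_cong2[of _ _ _ _ "(*)"] refl sum.cong) auto
  also have "\<dots> = 1" using A by simp
  finally have "bohr_coeff k 0 = of_nat (card A)"
    using mean[OF one] by simp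
  moreover have "cmod (bohr_coeff (\<lambda>s. f s * k s) 0) \<le> Re (bohr_coeff (\<lambda>s. of_real B * k s) 0)"
  proof (rule norm_bohr_coeff_0_le[OF AP[OF f(1)] AP_cmult[OF kAP]])
    show "cmod (f s * k s) \<le> Re (of_real B * k s)" for s
      using f(2)[of s] by (simp add: k_sq norm_mult norm_power mult_right_mono)
  qed
  ultimately have "card A * cmod (fejer A f x) \<le> B * card A"
    using mean[OF f(1)] by (simp add: bohr_coeff_cmult[OF kAP] norm_mult)
  moreover have "real (card A) > 0" using A by (simp add: card_gt_0_iff)
  ultimately show ?thesis by (metis mult.commute mult_le_cancel_left_pos)
qed

text \<open>Otherwise \<open>a\<close> would grow at least geometrically, which a polynomial bound excludes.\<close>

lemma exists_slow_growth_step: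
  fixes a :: "nat \<Rightarrow> nat"
  assumes "\<And>N. a N \<le> (N + 1) ^ m" "a 0 > 0" "e > 0"
  shows "\<exists>N. real (a (Suc N)) \<le> (1 + e) * real (a N)"
proof (rule ccontr)
  assume "\<not> ?thesis"
  then have step: "(1 + e) * real (a N) \<le> real (a (Suc N))" for N
    by (simp add: not_le less_imp_le)
  have "(1 + e) ^ N \<le> real (a N)" for N
  proof (induction N)
    case 0
    then show ?case using assms(2) by simp
  next
    case (Suc N)
    then have "(1 + e) * (1 + e) ^ N \<le> (1 + e) * real (a N)"
      using assms(3) by (intro mult_left_mono) auto
    with step[of N] show ?case by simp
  qed
  moreover have "real (a N) \<le> (real N + 1) ^ m" for N
    using assms(1)[of N] by (metis of_nat_1 of_nat_add of_nat_le_iff of_nat_power)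
  ultimately have le: "(1 + e) ^ N \<le> (real N + 1) ^ m" for N
    using order_trans by blast
  have "(\<lambda>N. (real N + 1) ^ m / (1 + e) ^ N) \<longlonglongrightarrow> 0"
    using assms(3) by real_asymp
  then have "eventually (\<lambda>N. (real N + 1) ^ m / (1 + e) ^ N < 1) sequentially"
    by (rule order_tendstoD) simp
  then obtain N where "(real N + 1) ^ m / (1 + e) ^ N < 1"
    by (auto simp: eventually_sequentially)
  with le[of N] assms(3) show False by (simp add: divide_simps split: if_splits)
qed

text \<open>Let \<open>A N\<close> consist of the sums of elements of \<open>L\<close> with multiplicities at most \<open>N\<close>. Its size
  is bounded by a polynomial in \<open>N\<close>, so for some \<open>N\<close> the set \<open>A (N + 1)\<close> is hardly larger than
  \<open>A N\<close>. Since it contains both \<open>A N\<close> and the translates \<open>l + A N\<close>, these overlap almost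
  completely. Linear relations among the elements of \<open>L\<close> only make these sets smaller.\<close>

lemma exists_folner_set:
  fixes L :: "(real ^ 'n) set"
  assumes L: "finite L" and "e > 0"
  shows "\<exists>A. finite A \<and> A \<noteq> {} \<and> (\<forall>l\<in>L. fejer_weight A l \<ge> 1 - e)"
proof -
  define A where "A N = (\<lambda>n. \<Sum>l\<in>L. real (n l) *\<^sub>R l) ` (L \<rightarrow>\<^sub>E {..N})" for N :: nat
  have fin: "finite (A N)" for N
    unfolding A_def using L by (intro finite_imageI finite_PiE) auto
  have ne: "A N \<noteq> {}" for N
    by (simp add: A_def PiE_eq_empty_iff)
  have mono: "A N \<subseteq> A (Suc N)" for N
    unfolding A_def by (intro image_mono PiE_mono) auto
  have shift: "(+) l ` A N \<subseteq> A (Suc N)" if "l \<in> L" for l N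
  proof -
    have "l + (\<Sum>k\<in>L. real (n k) *\<^sub>R k) \<in> A (Suc N)" if n: "n \<in> L \<rightarrow>\<^sub>E {..N}" for n
    proof -
      have "(\<Sum>k\<in>L. real ((n(l := Suc (n l))) k) *\<^sub>R k) = (\<Sum>k\<in>L. real (n k) *\<^sub>R k + (if k = l then l else 0))"
        by (intro sum.cong) (auto simp: scaleR_add_left)
      also have "\<dots> = l + (\<Sum>k\<in>L. real (n k) *\<^sub>R k)"
        using L \<open>l \<in> L\<close> by (simp add: sum.distrib)
      finally have "l + (\<Sum>k\<in>L. real (n k) *\<^sub>R k) = (\<Sum>k\<in>L. real ((n(l := Suc (n l))) k) *\<^sub>R k)" ..
      moreover have "n(l := Suc (n l)) \<in> L \<rightarrow>\<^sub>E {..Suc N}"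
        using n \<open>l \<in> L\<close> by (fastforce simp: PiE_iff extensional_def intro: le_SucI)
      ultimately show ?thesis unfolding A_def by blast
    qed
    then show ?thesis unfolding A_def[of N] by blast
  qed
  have "card (A N) \<le> (N + 1) ^ card L" for N
  proof -
    have "card (A N) \<le> card (L \<rightarrow>\<^sub>E {..N})"
      unfolding A_def using L by (intro card_image_le finite_PiE) auto
    also have "\<dots> = (N + 1) ^ card L" using L by (simp add: card_PiE)
    finally show ?thesis .
  qed
  moreover have "card (A 0) > 0" using fin ne by (simp add: card_gt_0_iff)
  ultimately obtain N where N: "real (card (A (Suc N))) \<le> (1 + e) * real (card (A N))"
    using exists_slow_growth_step[of "\<lambda>N. card (A N)" "card L" e] \<open>e > 0\<close> by blast
  have "fejer_weight (A N) l \<ge> 1 - e" if l: "l \<in> L" for l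
  proof -
    have inter: "(+) l ` A N \<inter> A N = (+) l ` {b \<in> A N. l + b \<in> A N}" by auto
    have cards: "card ((+) l ` A N) = card (A N)"
        "card ((+) l ` {b \<in> A N. l + b \<in> A N}) = card {b \<in> A N. l + b \<in> A N}"
      by (auto intro!: card_image simp: inj_on_def)
    have "card ((+) l ` A N \<union> A N) \<le> card (A (Suc N))"
      using shift[OF l] mono fin by (intro card_mono) auto
    moreover have "card ((+) l ` A N) + card (A N) = card ((+) l ` A N \<union> A N) + card ((+) l ` A N \<inter> A N)"
      using fin by (intro card_Un_Int) auto
    ultimately have "2 * card (A N) \<le> card (A (Suc N)) + card {b \<in> A N. l + b \<in> A N}"
      unfolding inter cards by simp
    from of_nat_mono[OF this, where 'a = real]
    have "2 * real (card (A N)) \<le> real (card (A (Suc N))) + real (card {b \<in> A N. l + b \<in> A N})"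
      by simp
    with N have "(1 - e) * real (card (A N)) \<le> real (card {b \<in> A N. l + b \<in> A N})"
      unfolding distrib_right left_diff_distrib by linarith
    moreover have "real (card (A N)) > 0" using fin[of N] ne[of N] by (simp add: card_gt_0_iff)
    ultimately show ?thesis by (simp add: fejer_weight_def pos_le_divide_eq)
  qed
  with fin ne show ?thesis by (intro exI[of _ "A N"]) auto
qed

text \<open>Approximate \<open>f\<close> by any trigonometric polynomial \<open>q\<close>, and take \<open>A\<close> almost invariant under the
  frequencies of \<open>q\<close>. Then \<^term>\<open>fejer A\<close> almost fixes \<open>q\<close>, and being a contraction it almost
  fixes \<open>f\<close>. The polynomial \<^term>\<open>fejer A f\<close> has the coefficients of \<open>f\<close> multiplied by numbers
  in \<open>[0,1]\<close>, hence no frequency outside the spectrum of \<open>f\<close>. The bound on the coefficients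
  serves the Wiener algebra.\<close>

theorem bochner_fejer:
  assumes f: "f \<in> AP" and "e > 0"
  shows "\<exists>p\<in>trig_polys (bohr_spectrum f).
    (\<forall>x. cmod (f x - p x) < e) \<and> (\<forall>l. cmod (bohr_coeff p l) \<le> cmod (bohr_coeff f l))"
proof -
  obtain q where q: "q \<in> trig_polys UNIV" and fq: "\<forall>x. cmod (f x - q x) < e/3"
    using f \<open>e > 0\<close> divide_pos_pos[of e 3] unfolding AP_eq_uniform_closure uniform_closure_def
    by fastforce
  let ?F = "bohr_spectrum q" and ?c = "bohr_coeff q"
  have F: "finite ?F" using finite_bohr_spectrum_trig_poly(1)[OF q] .
  have qAP: "q \<in> AP" using trig_polys_AP[OF q] .
  define S where "S = (\<Sum>l\<in>?F. cmod (?c l))"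
  have "S \<ge> 0" by (simp add: S_def sum_nonneg)
  \<comment> \<open>With weights at least \<open>1 - d\<close>, the distance from \<open>q\<close> to \<open>fejer A q\<close> is at most \<open>d * S\<close>.\<close>
  define d where "d = e / (3 * (S + 1))"
  have "d > 0" using \<open>S \<ge> 0\<close> \<open>e > 0\<close> by (simp add: d_def)
  then obtain A where A: "finite A" "A \<noteq> {}" "\<forall>l\<in>?F. fejer_weight A l \<ge> 1 - d"
    using exists_folner_set[OF F, of d] by blast
  have q_fejer: "cmod (q x - fejer A q x) \<le> e/3" for x
  proof -
    have sp: "bohr_spectrum (fejer A q) \<subseteq> ?F"
      using finite_bohr_spectrum_trig_poly(2)[OF fejer_in_trig_polys] .
    have qx: "q x = (\<Sum>l\<in>?F. ?c l * ap_exp l x)"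
      using fun_cong[OF trig_polys_eq_trig_sum[OF F q order_refl], of x] by (simp add: trig_sum_def)
    have fx: "fejer A q x = (\<Sum>l\<in>?F. of_real (fejer_weight A l) * ?c l * ap_exp l x)"
      using fun_cong[OF trig_polys_eq_trig_sum[OF F fejer_in_trig_polys sp], of x]
      by (simp add: trig_sum_def bohr_coeff_fejer[OF A(1)])
    have "q x - fejer A q x = (\<Sum>l\<in>?F. of_real (1 - fejer_weight A l) * (?c l * ap_exp l x))"
      unfolding qx fx sum_subtractf[symmetric] by (intro sum.cong) (auto simp: algebra_simps)
    also have "cmod \<dots> \<le> (\<Sum>l\<in>?F. d * cmod (?c l))"
    proof (rule sum_norm_le)
      fix l assume "l \<in> ?F"
      then have "\<bar>1 - fejer_weight A l\<bar> \<le> d"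
        using A fejer_weight_bounds[OF A(1), of l] by (auto simp: abs_le_iff)
      then show "cmod (of_real (1 - fejer_weight A l) * (?c l * ap_exp l x)) \<le> d * cmod (?c l)"
        by (simp add: norm_mult mult_right_mono del: of_real_diff)
    qed
    also have "\<dots> = d * S" by (simp add: S_def sum_distrib_left)
    also have "\<dots> \<le> e/3" using \<open>S \<ge> 0\<close> \<open>e > 0\<close> by (simp add: d_def divide_simps)
    finally show ?thesis .
  qed
  have "cmod (f x - fejer A f x) < e" for x
  proof -
    have "cmod (fejer A (\<lambda>x. q x - f x) x) \<le> e/3"
      using fq by (intro norm_fejer_le AP_diff qAP f A) (simp add: norm_minus_commute less_imp_le)
    then have "cmod (fejer A q x - fejer A f x) \<le> e/3" by (simp add: fejer_diff qAP f)
    moreover have "f x - fejer A f x = (f x - q x) + (q x - fejer A q x) + (fejer A q x - fejer A f x)"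
      by simp
    then have "cmod (f x - fejer A f x) \<le> cmod (f x - q x) + cmod (q x - fejer A q x) + cmod (fejer A q x - fejer A f x)"
      by (metis norm_triangle_ineq norm_triangle_mono order_refl)
    ultimately show ?thesis using fq[rule_format, of x] q_fejer[of x] by linarith
  qed
  moreover have "cmod (bohr_coeff (fejer A f) l) \<le> cmod (bohr_coeff f l)" for l
    using fejer_weight_bounds[OF A(1), of l]
    by (simp add: bohr_coeff_fejer[OF A(1)] norm_mult mult_left_le_one_le)
  ultimately show ?thesis using fejer_in_trig_polys by blast
qed

corollary bochner_fejer_sequence:
  assumes "f \<in> AP" "bohr_spectrum f \<subseteq> D"
  obtains p where "\<And>n. p n \<in> trig_polys D" "uniform_limit UNIV p f sequentially"
    "\<And>n l. cmod (bohr_coeff (p n) l) \<le> cmod (bohr_coeff f l)"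
proof -
  let ?P = "{p \<in> trig_polys D. \<forall>l. cmod (bohr_coeff p l) \<le> cmod (bohr_coeff f l)}"
  have "trig_polys (bohr_spectrum f) \<subseteq> trig_polys D"
    using assms(2) by (auto simp: trig_polys_def)
  then have "f \<in> uniform_closure ?P"
    using bochner_fejer[OF assms(1)] unfolding uniform_closure_def by blast
  then obtain p where p: "\<And>n. p n \<in> ?P" and lim: "uniform_limit UNIV p f sequentially"
    by (rule uniform_closureE) blast
  show thesis
  proof (rule that[OF _ lim])
    show "p n \<in> trig_polys D" "cmod (bohr_coeff (p n) l) \<le> cmod (bohr_coeff f l)" for n l
      using p[of n] by blast+
  qed
qed

text \<open>The approximants of the difference have empty spectrum, so they vanish.\<close>

corollary AP_eqI:
  assumes "f \<in> AP" "g \<in> AP" "\<And>l. bohr_coeff f l = bohr_coeff g l"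
  shows "f = g"
proof
  fix x
  let ?h = "\<lambda>x. f x - g x"
  have h: "?h \<in> AP" "bohr_spectrum ?h = {}"
    using assms by (auto simp: AP_diff bohr_spectrum_def bohr_coeff_diff)
  have small: "cmod (?h x) < e" if e: "e > 0" for e
  proof -
    obtain p where "p \<in> trig_polys {}" "cmod (?h x - p x) < e"
      using bochner_fejer[OF h(1) e] unfolding h(2) by blast
    then show ?thesis by (auto simp: trig_polys_def trig_sum_def)
  qed
  from small[of "cmod (?h x)"] show "f x = g x" by auto
qed

section \<open>Semicharacters acting as sup-norm contractions\<close>

text \<open>Only polynomials with frequencies in \<open>D\<close> are tested: the main examples, powers
  \<open>r\<close> to the \<open>a \<bullet> l\<close> with \<open>0 < r < 1\<close>, are unbounded on the frequencies with \<open>a \<bullet> l < 0\<close>.\<close>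

definition contractive_multiplier :: "(real ^ 'n) set \<Rightarrow> (real ^ 'n \<Rightarrow> real) \<Rightarrow> bool" where
  "contractive_multiplier D \<omega> \<longleftrightarrow>
     (\<forall>F c M. finite F \<longrightarrow> F \<subseteq> D \<longrightarrow> (\<forall>x. cmod (trig_sum F c x) \<le> M) \<longrightarrow>
       (\<forall>x. cmod (trig_sum F (\<lambda>l. of_real (\<omega> l) * c l) x) \<le> M))"

lemma contractive_multiplierD:
  assumes "contractive_multiplier D \<omega>" "finite F" "F \<subseteq> D" "\<And>x. cmod (trig_sum F c x) \<le> M"
  shows "cmod (trig_sum F (\<lambda>l. of_real (\<omega> l) * c l) x) \<le> M"
  using assms unfolding contractive_multiplier_def by blast

lemma contractive_multiplier_one: "contractive_multiplier D (\<lambda>_. 1)"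
  by (simp add: contractive_multiplier_def)

lemma contractive_multiplier_limit:
  assumes "\<And>n. contractive_multiplier D (\<omega> n)" "\<And>l. l \<in> D \<Longrightarrow> (\<lambda>n. \<omega> n l) \<longlonglongrightarrow> \<psi> l"
  shows "contractive_multiplier D \<psi>"
  unfolding contractive_multiplier_def
proof (intro allI impI)
  fix F c M x assume F: "finite F" "F \<subseteq> D" "\<forall>x. cmod (trig_sum F c x) \<le> M"
  have "(\<lambda>n. trig_sum F (\<lambda>l. of_real (\<omega> n l) * c l) x) \<longlonglongrightarrow> trig_sum F (\<lambda>l. of_real (\<psi> l) * c l) x"
    unfolding trig_sum_def using F assms(2) by (intro tendsto_intros) auto
  from tendsto_norm[OF this] show "cmod (trig_sum F (\<lambda>l. of_real (\<psi> l) * c l) x) \<le> M"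
    by (rule tendsto_upperbound)
      (use F contractive_multiplierD[OF assms(1) F(1,2)] in \<open>auto intro!: always_eventually\<close>)
qed

text \<open>The second factor acts after the first one has removed all frequencies outside \<open>E\<close>.\<close>

lemma contractive_multiplier_mult:
  assumes 1: "contractive_multiplier D \<omega>" and 2: "contractive_multiplier E \<psi>"
    and supp: "\<And>l. l \<in> D \<Longrightarrow> l \<notin> E \<Longrightarrow> \<omega> l = 0"
  shows "contractive_multiplier D (\<lambda>l. \<omega> l * \<psi> l)"
  unfolding contractive_multiplier_def
proof (intro allI impI)
  fix F c M x assume F: "finite F" "F \<subseteq> D" "\<forall>x. cmod (trig_sum F c x) \<le> M"
  have restrict: "trig_sum F (\<lambda>l. of_real (\<omega> l) * d l) = trig_sum (F \<inter> E) (\<lambda>l. of_real (\<omega> l) * d l)" for d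
    unfolding trig_sum_def using F supp by (intro ext sum.mono_neutral_right) auto
  have "cmod (trig_sum (F \<inter> E) (\<lambda>l. of_real (\<psi> l) * (of_real (\<omega> l) * c l)) x) \<le> M"
    using F contractive_multiplierD[OF 1 F(1,2)]
    by (intro contractive_multiplierD[OF 2]) (auto simp flip: restrict)
  also have "(\<lambda>l. of_real (\<psi> l) * (of_real (\<omega> l) * c l)) = (\<lambda>l. of_real (\<omega> l) * (of_real (\<psi> l) * c l))"
    by (simp add: mult_ac)
  finally show "cmod (trig_sum F (\<lambda>l. of_real (\<omega> l * \<psi> l) * c l) x) \<le> M"
    using restrict[of "\<lambda>l. of_real (\<psi> l) * c l"] by (simp add: mult.assoc)
qed

text \<open>Taking \<open>n\<close>-th roots and letting \<open>n\<close> grow removes the constant. The same trick serves the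
  Phragmen--Lindelof argument and the bounds on characters.\<close>

lemma le_if_powers_le:
  fixes x y C :: real
  assumes "x \<ge> 0" "y \<ge> 0" "\<And>n. x ^ n \<le> C * y ^ n"
  shows "x \<le> y"
proof (rule ccontr)
  assume "\<not> x \<le> y"
  then have "y < x" by simp
  show False
  proof (cases "y = 0")
    case True
    then show False using assms(3)[of 1] \<open>y < x\<close> by simp
  next
    case False
    then have "1 < x / y" using assms(2) \<open>y < x\<close> by simp
    then obtain n where "C < (x / y) ^ n" using real_arch_pow by blast
    then show False
      using assms(3)[of n] False assms(2) by (simp add: power_divide pos_less_divide_eq)
  qed
qed

text \<open>A Phragmen--Lindelof argument. Nonnegative exponents make the sum \<open>G\<close> bounded by some \<open>B\<close> on the
  closed upper half-plane. Dividing \<open>G\<^sup>n\<close> by \<open>z + \<i>\<close> gives a function that tends to 0 at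
  infinity and is still bounded by \<open>M\<^sup>n\<close> on the real line, so the maximum modulus principle on
  large half-discs yields \<open>|G w|\<^sup>n \<le> |w + \<i>| M\<^sup>n\<close>, and \<open>|w + \<i>|\<close> disappears on taking roots.
  A small \<open>e > 0\<close> is added to \<open>M\<close> because the radius of the half-disc is chosen by dividing by
  its powers.\<close>

lemma bounded_exponential_sum_upper_half_plane:
  fixes a :: "'j \<Rightarrow> real" and c :: "'j \<Rightarrow> complex"
  assumes a: "\<And>j. j \<in> J \<Longrightarrow> a j \<ge> 0"
    and M: "\<And>t :: real. cmod (\<Sum>j\<in>J. c j * exp (\<i> * of_real t * of_real (a j))) \<le> M"
    and w: "Im w \<ge> 0"
  shows "cmod (\<Sum>j\<in>J. c j * exp (\<i> * w * of_real (a j))) \<le> M"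
proof -
  define G where "G z = (\<Sum>j\<in>J. c j * exp (\<i> * z * of_real (a j)))" for z
  define B where "B = (\<Sum>j\<in>J. cmod (c j))"
  have GB: "cmod (G z) \<le> B" if "Im z \<ge> 0" for z
    unfolding G_def B_def
  proof (rule sum_norm_le)
    fix j assume "j \<in> J"
    then have "exp (- (Im z * a j)) \<le> 1" using a that by simp
    then show "cmod (c j * exp (\<i> * z * of_real (a j))) \<le> cmod (c j)"
      by (simp add: norm_mult mult_left_le)
  qed
  have "cmod (G w) \<le> M + e" if "e > 0" for e
  proof (rule le_if_powers_le[where C = "cmod (w + \<i>)"])
    have "M \<ge> 0" using M[of 0] norm_ge_zero order_trans by blast
    then show "M + e \<ge> 0" using that by simp
    fix n
    \<comment> \<open>On the arc \<open>|z| = R\<close> this gives \<open>B\<^sup>n \<le> (M + e)\<^sup>n (R - 1) \<le> (M + e)\<^sup>n |z + \<i>|\<close>.\<close>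
    define R where "R = max (cmod w) (1 + B ^ n / (M + e) ^ n)"
    define S where "S = cball 0 R \<inter> {z. 0 \<le> Im z}"
    have pos: "(M + e) ^ n > 0" using \<open>M \<ge> 0\<close> that by simp
    have "closed S"
      unfolding S_def by (intro closed_Int closed_cball closed_halfspace_Im_ge)
    have nz: "z + \<i> \<noteq> 0" if "Im z \<ge> 0" for z
      using that by (auto simp: complex_eq_iff)
    have hol: "(\<lambda>z. G z ^ n / (z + \<i>)) holomorphic_on S"
      unfolding G_def S_def by (intro holomorphic_intros) (use nz in auto)
    have "cmod (G w ^ n / (w + \<i>)) \<le> (M + e) ^ n"
    proof (rule maximum_modulus_frontier[of "\<lambda>z. G z ^ n / (z + \<i>)" S])
      show "(\<lambda>z. G z ^ n / (z + \<i>)) holomorphic_on interior S"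
        using hol interior_subset by (rule holomorphic_on_subset)
      show "continuous_on (closure S) (\<lambda>z. G z ^ n / (z + \<i>))"
        using hol \<open>closed S\<close> by (simp add: holomorphic_on_imp_continuous_on)
      show "bounded S" unfolding S_def by (intro bounded_Int) auto
      show "w \<in> S" using w by (simp add: S_def R_def)
      fix z assume "z \<in> frontier S"
      then have zS: "z \<in> S" and "z \<notin> interior S"
        using \<open>closed S\<close> by (auto simp: frontier_def)
      have "z \<notin> ball 0 R \<inter> {z. 0 < Im z}"
      proof
        assume "z \<in> ball 0 R \<inter> {z. 0 < Im z}"
        moreover have "ball 0 R \<inter> {z. 0 < Im z} \<subseteq> interior S"
          by (intro interior_maximal open_Int open_ball open_halfspace_Im_gt) (auto simp: S_def)
        ultimately show False using \<open>z \<notin> interior S\<close> by blast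
      qed
      with zS consider "Im z = 0" | "cmod z = R" "Im z \<ge> 0" by (force simp: S_def)
      then show "cmod (G z ^ n / (z + \<i>)) \<le> (M + e) ^ n"
      proof cases
        case 1
        then have "z = of_real (Re z)" by (simp add: complex_eq_iff)
        then have "cmod (G z) \<le> M + e"
          using M[of "Re z"] that unfolding G_def by (metis add_increasing2 less_imp_le)
        then have "cmod (G z) ^ n \<le> (M + e) ^ n" by (rule power_mono) simp
        also have "1 \<le> cmod (z + \<i>)"
          using abs_Im_le_cmod[of "z + \<i>"] 1 by simp
        then have "(M + e) ^ n \<le> (M + e) ^ n * cmod (z + \<i>)"
          using pos by simp
        finally show ?thesis
          using nz[of z] 1 by (simp add: norm_divide norm_power pos_divide_le_eq)
      next
        case 2
        have "B ^ n / (M + e) ^ n \<le> R - 1" by (simp add: R_def)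
        also have "\<dots> \<le> cmod (z + \<i>)"
          using norm_diff_ineq[of z "\<i>"] 2(1) by simp
        finally have "B ^ n \<le> (M + e) ^ n * cmod (z + \<i>)"
          using pos by (simp add: pos_divide_le_eq mult.commute)
        moreover have "cmod (G z) ^ n \<le> B ^ n"
          using GB[OF 2(2)] by (rule power_mono) simp
        ultimately show ?thesis
          using nz[OF 2(2)] by (simp add: norm_divide norm_power pos_divide_le_eq)
      qed
    qed
    then show "cmod (G w) ^ n \<le> cmod (w + \<i>) * (M + e) ^ n"
      using nz[OF w] by (simp add: norm_divide norm_power pos_divide_le_eq mult.commute)
  qed simp
  then show ?thesis unfolding G_def by (rule field_le_epsilon)
qed

text \<open>The power \<open>r\<close> to the \<open>a \<bullet> l\<close> with the convention that \<open>0\<close> to the power \<open>0\<close> is \<open>1\<close>,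
  whereas \<open>0 powr 0 = 0\<close>. At \<open>r = 0\<close> it is the indicator of the hyperplane orthogonal to \<open>a\<close>.\<close>

definition decay :: "real ^ 'n \<Rightarrow> real \<Rightarrow> real ^ 'n \<Rightarrow> real" where
  "decay a r l = (if a \<bullet> l = 0 then 1 else r powr (a \<bullet> l))"

text \<open>For \<open>r > 0\<close>, multiplying the coefficients by powers of \<open>r\<close> evaluates the holomorphic extension
  of \<open>t \<mapsto> p (x + t a)\<close> at the point \<open>- \<i> ln r\<close> of the closed upper half-plane. The case \<open>r = 0\<close>
  is the limit of positive \<open>r\<close>.\<close>

lemma contractive_multiplier_decay:
  fixes a :: "real ^ 'n"
  assumes a: "\<And>l. l \<in> D \<Longrightarrow> 0 \<le> a \<bullet> l" and r: "0 \<le> r" "r \<le> 1"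
  shows "contractive_multiplier D (decay a r)"
proof -
  have pos: "contractive_multiplier D (decay a r)" if r: "0 < r" "r \<le> 1" for r
    unfolding contractive_multiplier_def
  proof (intro allI impI)
    fix F c M x assume F: "finite F" "F \<subseteq> D" "\<forall>x. cmod (trig_sum F c x) \<le> M"
    have shift: "trig_sum F c (x + t *\<^sub>R a)
        = (\<Sum>l\<in>F. (c l * ap_exp l x) * exp (\<i> * of_real t * of_real (a \<bullet> l)))" for t
      by (simp add: trig_sum_def ap_exp_shift mult.assoc)
        (simp add: ap_exp_def inner_commute mult_ac)
    have "cmod (\<Sum>l\<in>F. (c l * ap_exp l x) * exp (\<i> * (\<i> * of_real (- ln r)) * of_real (a \<bullet> l))) \<le> M"
    proof (rule bounded_exponential_sum_upper_half_plane)
      show "0 \<le> a \<bullet> l" if "l \<in> F" for l using a F(2) that by blast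
      show "cmod (\<Sum>l\<in>F. (c l * ap_exp l x) * exp (\<i> * of_real t * of_real (a \<bullet> l))) \<le> M" for t
        using F(3) by (simp flip: shift)
    qed (use r in simp)
    also have "(\<Sum>l\<in>F. (c l * ap_exp l x) * exp (\<i> * (\<i> * of_real (- ln r)) * of_real (a \<bullet> l)))
        = trig_sum F (\<lambda>l. of_real (decay a r l) * c l) x"
      unfolding trig_sum_def
    proof (rule sum.cong)
      fix l
      have "exp (\<i> * (\<i> * of_real (- ln r)) * of_real (a \<bullet> l)) = of_real (exp ((a \<bullet> l) * ln r))"
        unfolding exp_of_real[symmetric] by (simp add: algebra_simps flip: mult.assoc)
      also have "exp ((a \<bullet> l) * ln r) = decay a r l"
        using r by (simp add: decay_def powr_def)
      finally show "(c l * ap_exp l x) * exp (\<i> * (\<i> * of_real (- ln r)) * of_real (a \<bullet> l))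
          = of_real (decay a r l) * c l * ap_exp l x"
        by simp
    qed simp
    finally show "cmod (trig_sum F (\<lambda>l. of_real (decay a r l) * c l) x) \<le> M" .
  qed
  show ?thesis
  proof (cases "r = 0")
    case True
    show ?thesis
    proof (rule contractive_multiplier_limit)
      show "contractive_multiplier D (decay a (inverse (real (Suc n))))" for n
        by (rule pos) (auto simp: divide_simps)
      fix l assume "l \<in> D"
      show "(\<lambda>n. decay a (inverse (real (Suc n))) l) \<longlonglongrightarrow> decay a r l"
      proof (cases "a \<bullet> l = 0")
        case False
        with a[OF \<open>l \<in> D\<close>] have "0 < a \<bullet> l" by simp
        then have "(\<lambda>n. inverse (real (Suc n)) powr (a \<bullet> l)) \<longlonglongrightarrow> 0"
          by (intro tendsto_zero_powrI[OF LIMSEQ_inverse_real_of_nat tendsto_const]) auto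
        with False True show ?thesis by (simp add: decay_def)
      qed (simp add: decay_def)
    qed
  qed (use pos r in simp)
qed

text \<open>Multiplicativity concerns only sums that stay in \<open>D\<close>: the convex sets to which the inductive
  construction of the path applies need not be closed under addition.\<close>

definition contractive_semicharacter :: "(real ^ 'n) set \<Rightarrow> (real ^ 'n \<Rightarrow> real) \<Rightarrow> bool" where
  "contractive_semicharacter D \<omega> \<longleftrightarrow>
     \<omega> 0 = 1 \<and> (\<forall>l\<in>D. 0 \<le> \<omega> l \<and> \<omega> l \<le> 1) \<and>
     (\<forall>l\<in>D. \<forall>m\<in>D. l + m \<in> D \<longrightarrow> \<omega> (l + m) = \<omega> l * \<omega> m) \<and>
     contractive_multiplier D \<omega>"

lemma contractive_semicharacter_mono:
  "contractive_semicharacter D \<omega> \<Longrightarrow> E \<subseteq> D \<Longrightarrow> contractive_semicharacter E \<omega>"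
  unfolding contractive_semicharacter_def contractive_multiplier_def by (meson subset_iff order_trans)

lemma contractive_semicharacter_decay:
  assumes "\<And>l. l \<in> D \<Longrightarrow> 0 \<le> a \<bullet> l" "0 \<le> r" "r \<le> 1"
  shows "contractive_semicharacter D (decay a r)"
  unfolding contractive_semicharacter_def
proof (intro conjI ballI impI)
  fix l assume l: "l \<in> D"
  show "0 \<le> decay a r l" "decay a r l \<le> 1"
    using assms(1)[OF l] assms(2,3) by (auto simp: decay_def intro: powr_le1)
  fix m assume m: "m \<in> D"
  show "decay a r (l + m) = decay a r l * decay a r m"
    using assms(1)[OF l] assms(1)[OF m] by (auto simp: decay_def inner_add_right powr_add)
qed (use assms contractive_multiplier_decay in \<open>auto simp: decay_def\<close>)

section \<open>A path of semicharacters on a pointed convex set\<close>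

definition contracting_path :: "(real ^ 'n) set \<Rightarrow> (real \<Rightarrow> real ^ 'n \<Rightarrow> real) \<Rightarrow> bool" where
  "contracting_path D \<omega> \<longleftrightarrow>
     (\<forall>t\<in>{0..1}. contractive_semicharacter D (\<omega> t)) \<and>
     (\<forall>l\<in>D. continuous_on {0..1} (\<lambda>t. \<omega> t l)) \<and>
     (\<forall>l\<in>D. \<omega> 0 l = 1) \<and> (\<forall>l\<in>D. \<omega> 1 l = (if l = 0 then 1 else 0))"

text \<open>Induction on the dimension of the span of \<open>C\<close>. A functional \<open>a\<close> that is nonnegative on \<open>C\<close> gives
  the first half of the path: with \<open>r\<close> running from 1 to 0, the multipliers \<open>decay a r\<close> kill
  everything that is not orthogonal to \<open>a\<close>. The second half is the path for the part of \<open>C\<close>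
  orthogonal to \<open>a\<close>, extended by 0. Because \<open>a\<close> can be chosen in the span of \<open>C\<close>, that part
  spans a strictly smaller space.\<close>

lemma exists_contracting_path:
  fixes C :: "(real ^ 'n) set"
  assumes "convex C" "0 \<notin> C"
  shows "\<exists>\<omega>. contracting_path (insert 0 C) \<omega>"
  using assms
proof (induction "dim C" arbitrary: C rule: less_induct)
  case less
  show ?case
  proof (cases "C = {}")
    case True
    have "contracting_path (insert 0 C) (\<lambda>_ _. 1)"
      by (auto simp: contracting_path_def contractive_semicharacter_def contractive_multiplier_one True)
    then show ?thesis by blast
  next
    case False
    obtain a where a: "a \<in> span C" "a \<noteq> 0" "\<And>l. l \<in> C \<Longrightarrow> 0 \<le> a \<bullet> l"
      by (rule separating_hyperplane_set_0_inspan[OF less.prems(1) False less.prems(2)]) blast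
    define C' where "C' = C \<inter> {l. a \<bullet> l = 0}"
    have "span C' \<subseteq> {l. a \<bullet> l = 0}"
      by (rule span_minimal) (auto simp: C'_def subspace_hyperplane)
    with a have "a \<notin> span C'" by auto
    moreover have "span C' \<subseteq> span C" unfolding C'_def by (intro span_mono) auto
    ultimately have "dim C' < dim C" using a(1) by (intro dim_psubset) blast
    moreover have "convex C'"
      unfolding C'_def using less.prems(1) by (intro convex_Int convex_hyperplane)
    moreover have "0 \<notin> C'" using less.prems(2) by (simp add: C'_def)
    ultimately obtain \<psi> where "contracting_path (insert 0 C') \<psi>"
      using less.hyps by blast
    then have \<psi>: "\<And>t. t \<in> {0..1} \<Longrightarrow> contractive_semicharacter (insert 0 C') (\<psi> t)"
        "\<And>l. l \<in> insert 0 C' \<Longrightarrow> continuous_on {0..1} (\<lambda>t. \<psi> t l)"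
        "\<And>l. l \<in> insert 0 C' \<Longrightarrow> \<psi> 0 l = 1"
        "\<And>l. l \<in> insert 0 C' \<Longrightarrow> \<psi> 1 l = (if l = 0 then 1 else 0)"
      unfolding contracting_path_def by blast+
    have a0: "0 \<le> a \<bullet> l" if "l \<in> insert 0 C" for l using a(3) that by auto
    have in_C': "l \<in> insert 0 C' \<longleftrightarrow> a \<bullet> l = 0" if "l \<in> insert 0 C" for l
      using that by (auto simp: C'_def)
    define \<omega> where "\<omega> t l = (if t \<le> 1/2 then decay a (1 - 2 * t) l else decay a 0 l * \<psi> (2 * t - 1) l)" for t l
    have zero: "decay a 0 l = (if a \<bullet> l = 0 then 1 else 0)" for l
      by (simp add: decay_def)
    have semi: "contractive_semicharacter (insert 0 C) (\<lambda>l. decay a 0 l * \<psi> s l)" if s: "s \<in> {0..1}" for s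
      unfolding contractive_semicharacter_def
    proof (intro conjI ballI impI)
      note d = \<psi>(1)[OF s, unfolded contractive_semicharacter_def]
      show "decay a 0 0 * \<psi> s 0 = 1" using d by (simp add: zero)
      show "contractive_multiplier (insert 0 C) (\<lambda>l. decay a 0 l * \<psi> s l)"
      proof (rule contractive_multiplier_mult[of _ _ "insert 0 C'"])
        show "contractive_multiplier (insert 0 C) (decay a 0)"
          using a0 by (intro contractive_multiplier_decay) auto
        show "contractive_multiplier (insert 0 C') (\<psi> s)" using d by blast
        show "decay a 0 l = 0" if "l \<in> insert 0 C" "l \<notin> insert 0 C'" for l
          using that in_C'[of l] by (simp add: zero)
      qed
      fix l assume l: "l \<in> insert 0 C"
      show "0 \<le> decay a 0 l * \<psi> s l" "decay a 0 l * \<psi> s l \<le> 1"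
        using d in_C'[OF l] by (auto simp: zero)
      fix m assume m: "m \<in> insert 0 C" "l + m \<in> insert 0 C"
      have sum0: "a \<bullet> (l + m) = 0 \<longleftrightarrow> a \<bullet> l = 0 \<and> a \<bullet> m = 0"
        using a0[OF l] a0[OF m(1)] by (auto simp: inner_add_right)
      show "decay a 0 (l + m) * \<psi> s (l + m) = decay a 0 l * \<psi> s l * (decay a 0 m * \<psi> s m)"
      proof (cases "a \<bullet> l = 0 \<and> a \<bullet> m = 0")
        case True
        then have "l \<in> insert 0 C'" "m \<in> insert 0 C'" "l + m \<in> insert 0 C'"
          using in_C' l m sum0 by blast+
        then have "\<psi> s (l + m) = \<psi> s l * \<psi> s m" using d by blast
        with True sum0 show ?thesis by (simp add: zero)
      qed (use sum0 in \<open>auto simp: zero\<close>)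
    qed
    have "contracting_path (insert 0 C) \<omega>"
      unfolding contracting_path_def
    proof (intro conjI ballI)
      fix t :: real assume t: "t \<in> {0..1}"
      show "contractive_semicharacter (insert 0 C) (\<omega> t)"
      proof (cases "t \<le> 1/2")
        case True
        then have "contractive_semicharacter (insert 0 C) (decay a (1 - 2 * t))"
          using a0 t by (intro contractive_semicharacter_decay) auto
        with True show ?thesis by (simp add: \<omega>_def[abs_def])
      next
        case False
        then show ?thesis
          using semi[of "2 * t - 1"] t by (simp add: \<omega>_def[abs_def])
      qed
    next
      fix l assume l: "l \<in> insert 0 C"
      show "\<omega> 0 l = 1"
        using powr_one_eq_one by (simp add: \<omega>_def decay_def)
      show "\<omega> 1 l = (if l = 0 then 1 else 0)"
        using \<psi>(4)[of l] in_C'[OF l] by (auto simp: \<omega>_def zero)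
      show "continuous_on {0..1} (\<lambda>t. \<omega> t l)"
        unfolding \<omega>_def
      proof (rule continuous_on_cases_le)
        show "continuous_on {t \<in> {0..1}. t \<le> 1/2} (\<lambda>t. decay a (1 - 2 * t) l)"
        proof (cases "a \<bullet> l = 0")
          case False
          then have "0 < a \<bullet> l" using a0[OF l] by simp
          then show ?thesis
            using False unfolding decay_def
            by (simp, intro continuous_on_powr' continuous_intros) auto
        qed (simp add: decay_def)
        show "continuous_on {t \<in> {0..1}. 1/2 \<le> t} (\<lambda>t. decay a 0 l * \<psi> (2 * t - 1) l)"
        proof (cases "a \<bullet> l = 0")
          case True
          then have "continuous_on {0..1} (\<lambda>t. \<psi> t l)" using \<psi>(2) in_C'[OF l] by blast
          then have "continuous_on {t \<in> {0..1}. 1/2 \<le> t} (\<lambda>t. \<psi> (2 * t - 1) l)"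
            by (rule continuous_on_compose2) (auto intro!: continuous_intros)
          with True show ?thesis by (simp add: zero)
        qed (simp add: zero)
        show "decay a (1 - 2 * t) l = decay a 0 l * \<psi> (2 * t - 1) l" if "t = 1/2" for t
        proof -
          have "1 - 2 * t = 0" "2 * t - 1 = 0" using that by auto
          then show ?thesis using \<psi>(3)[of l] in_C'[OF l] by (simp add: zero)
        qed
      qed (intro continuous_intros)
    qed
    then show ?thesis by blast
  qed
qed

text \<open>A halfspace is a convex cone that contains no line, so it stays convex when 0 is removed.\<close>

corollary halfspace_contracting_path:
  fixes S :: "(real ^ 'n) set"
  assumes "is_halfspace S" "D \<subseteq> S"
  shows "\<exists>\<omega>. contracting_path D \<omega>"
proof -
  have S: "\<And>l m. l \<in> S \<Longrightarrow> m \<in> S \<Longrightarrow> l + m \<in> S" "\<And>l r. l \<in> S \<Longrightarrow> 0 \<le> r \<Longrightarrow> r *\<^sub>R l \<in> S"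
    using assms(1) unfolding is_halfspace_def by blast+
  have pointed: "l = 0" if "l \<in> S" "- l \<in> S" for l
  proof -
    have "l \<in> S \<inter> uminus ` S" using that by (metis IntI imageI minus_minus)
    then show ?thesis using assms(1) unfolding is_halfspace_def by blast
  qed
  have "convex (S - {0})"
    unfolding convex_def
  proof (intro ballI allI impI)
    fix x y and u v :: real
    assume x: "x \<in> S - {0}" and y: "y \<in> S - {0}" and uv: "0 \<le> u" "0 \<le> v" "u + v = 1"
    have in_S: "u *\<^sub>R x \<in> S" "v *\<^sub>R y \<in> S" using x y uv S(2) by auto
    moreover have "u *\<^sub>R x + v *\<^sub>R y \<noteq> 0"
    proof
      assume "u *\<^sub>R x + v *\<^sub>R y = 0"
      then have "- (u *\<^sub>R x) = v *\<^sub>R y" "- (v *\<^sub>R y) = u *\<^sub>R x"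
        by (simp_all add: add_eq_0_iff2 add_eq_0_iff)
      with in_S have "u *\<^sub>R x = 0" "v *\<^sub>R y = 0" using pointed by metis+
      with x y uv show False by auto
    qed
    ultimately show "u *\<^sub>R x + v *\<^sub>R y \<in> S - {0}" using S(1) by auto
  qed
  then obtain \<omega> where \<omega>: "contracting_path (insert 0 (S - {0})) \<omega>"
    using exists_contracting_path by blast
  have "D \<subseteq> insert 0 (S - {0})" using assms(2) by auto
  with \<omega> have "contracting_path D \<omega>"
    unfolding contracting_path_def
    by (auto intro: contractive_semicharacter_mono)
  then show ?thesis by blast
qed

section \<open>Extending multipliers from trigonometric polynomials\<close>

lemma norm_multiplier_trig_poly_le:
  assumes "contractive_multiplier D \<omega>" "p \<in> trig_polys D" "finite F" "bohr_spectrum p \<subseteq> F"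
    and "\<And>x. cmod (p x) \<le> M"
  shows "cmod (trig_sum F (\<lambda>l. of_real (\<omega> l) * bohr_coeff p l) x) \<le> M"
proof -
  let ?G = "bohr_spectrum p"
  have G: "finite ?G" "?G \<subseteq> D" using finite_bohr_spectrum_trig_poly[OF assms(2)] by auto
  have "trig_sum F (\<lambda>l. of_real (\<omega> l) * bohr_coeff p l) = trig_sum ?G (\<lambda>l. of_real (\<omega> l) * bohr_coeff p l)"
    unfolding trig_sum_def using assms(3,4)
    by (intro ext sum.mono_neutral_right) (auto simp: bohr_spectrum_def)
  moreover have "cmod (trig_sum ?G (\<lambda>l. of_real (\<omega> l) * bohr_coeff p l) x) \<le> M"
    using assms(5) trig_polys_eq_trig_sum[OF G(1) assms(2) order_refl]
    by (intro contractive_multiplierD[OF assms(1) G]) metis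
  ultimately show ?thesis by simp
qed

lemma AP_specD: "f \<in> AP_spec D \<Longrightarrow> f \<in> AP" "f \<in> AP_spec D \<Longrightarrow> l \<notin> D \<Longrightarrow> bohr_coeff f l = 0"
  by (auto simp: AP_spec_def bohr_spectrum_def)

lemma AP_specI: "f \<in> AP \<Longrightarrow> (\<And>l. l \<notin> D \<Longrightarrow> bohr_coeff f l = 0) \<Longrightarrow> f \<in> AP_spec D"
  by (auto simp: AP_spec_def bohr_spectrum_def)

lemma trig_polys_AP_spec: "p \<in> trig_polys D \<Longrightarrow> p \<in> AP_spec D"
  using finite_bohr_spectrum_trig_poly(2)[of p D] trig_polys_AP[of p D] by (auto simp: AP_spec_def)

lemma AP_spec_add: "f \<in> AP_spec D \<Longrightarrow> g \<in> AP_spec D \<Longrightarrow> (\<lambda>x. f x + g x) \<in> AP_spec D"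
  by (intro AP_specI AP_add) (auto simp: AP_specD bohr_coeff_add)

lemma AP_spec_cmult: "f \<in> AP_spec D \<Longrightarrow> (\<lambda>x. c * f x) \<in> AP_spec D"
  by (intro AP_specI AP_cmult) (auto simp: AP_specD bohr_coeff_cmult)

lemma AP_spec_diff: "f \<in> AP_spec D \<Longrightarrow> g \<in> AP_spec D \<Longrightarrow> (\<lambda>x. f x - g x) \<in> AP_spec D"
  by (intro AP_specI AP_diff) (auto simp: AP_specD bohr_coeff_diff)

lemma AP_spec_approx:
  assumes "f \<in> AP_spec D"
  obtains p where "\<And>n. p n \<in> trig_polys D" "uniform_limit UNIV p f sequentially"
    "\<And>n l. cmod (bohr_coeff (p n) l) \<le> cmod (bohr_coeff f l)"
proof (rule bochner_fejer_sequence[of f D])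
  show "f \<in> AP" using assms by (rule AP_specD)
  show "bohr_spectrum f \<subseteq> D" using assms by (simp add: AP_spec_def)
next
  fix p
  assume "\<And>n. p n \<in> trig_polys D" "uniform_limit UNIV p f sequentially"
    "\<And>n l. cmod (bohr_coeff (p n) l) \<le> cmod (bohr_coeff f l)"
  then show thesis by (rule that)
qed

text \<open>On polynomials the multiplier is linear and contractive, so it maps a uniformly convergent sequence
  of polynomials with frequencies in \<open>D\<close> to a uniformly Cauchy sequence. Such a sequence exists by
  \<open>bochner_fejer\<close>; the coefficients and the bound pass to the limit.\<close>

lemma exists_multiplier:
  fixes f :: "real ^ 'n \<Rightarrow> complex"
  assumes \<omega>: "contractive_multiplier D \<omega>" and f: "f \<in> AP_spec D"
  shows "\<exists>g\<in>AP. (\<forall>l. bohr_coeff g l = of_real (\<omega> l) * bohr_coeff f l) \<and>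
    (\<forall>M. (\<forall>x. cmod (f x) \<le> M) \<longrightarrow> (\<forall>x. cmod (g x) \<le> M))"
proof -
  obtain p where p: "\<And>n. p n \<in> trig_polys D" and lim: "uniform_limit UNIV p f sequentially"
    by (rule AP_spec_approx[OF f]) (rule that)
  have pAP: "p n \<in> AP" for n using p by (rule trig_polys_AP)
  have fAP: "f \<in> AP" using AP_specD(1)[OF f] .
  define q where "q n = trig_sum (bohr_spectrum (p n)) (\<lambda>l. of_real (\<omega> l) * bohr_coeff (p n) l)" for n
  have fin: "finite (bohr_spectrum (p n))" for n using finite_bohr_spectrum_trig_poly(1)[OF p] .
  have qAP: "q n \<in> AP" for n unfolding q_def using fin by (rule trig_sum_AP)
  have q_coeff: "bohr_coeff (q n) l = of_real (\<omega> l) * bohr_coeff (p n) l" for n l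
    unfolding q_def bohr_coeff_trig_sum[OF fin] by (simp add: bohr_spectrum_def)
  have q_diff: "cmod (q m x - q n x) \<le> M" if M: "\<And>x. cmod (p m x - p n x) \<le> M" for m n M x
  proof -
    let ?d = "\<lambda>x. p m x - p n x" and ?F = "bohr_spectrum (p m) \<union> bohr_spectrum (p n)"
    have extend: "q k = trig_sum ?F (\<lambda>l. of_real (\<omega> l) * bohr_coeff (p k) l)" if "k = m \<or> k = n" for k
      unfolding q_def trig_sum_def using fin that
      by (intro ext sum.mono_neutral_left) (auto simp: bohr_spectrum_def)
    have "q m x - q n x = trig_sum ?F (\<lambda>l. of_real (\<omega> l) * bohr_coeff ?d l) x"
      using extend[of m] extend[of n]
      by (simp add: trig_sum_def bohr_coeff_diff pAP algebra_simps sum_subtractf)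
    also have "cmod \<dots> \<le> M"
      by (rule norm_multiplier_trig_poly_le[OF \<omega> trig_polys_diff[OF p p]])
        (use fin M in \<open>auto simp: bohr_spectrum_def bohr_coeff_diff pAP\<close>)
    finally show ?thesis .
  qed
  have "uniformly_Cauchy_on UNIV q"
  proof (rule uniformly_Cauchy_onI)
    fix e :: real assume "e > 0"
    then obtain N where N: "\<And>n x. n \<ge> N \<Longrightarrow> dist (p n x) (f x) < e/4"
      using lim unfolding uniform_limit_sequentially_iff
      by (metis UNIV_I divide_pos_pos zero_less_numeral)
    have "dist (q m x) (q n x) < e" if "m \<ge> N" "n \<ge> N" for m n x
    proof -
      have "cmod (p m y - p n y) \<le> e/2" for y
        using N[OF that(1), of y] N[OF that(2), of y] dist_triangle2[of "p m y" "p n y" "f y"]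
        by (simp add: dist_norm)
      from q_diff[OF this, of x] \<open>e > 0\<close> show ?thesis by (simp add: dist_norm)
    qed
    then show "\<exists>N. \<forall>x\<in>UNIV. \<forall>m\<ge>N. \<forall>n\<ge>N. dist (q m x) (q n x) < e" by blast
  qed
  then obtain g where g: "uniform_limit UNIV q g sequentially"
    using Cauchy_uniformly_convergent unfolding uniformly_convergent_on_def by blast
  have gAP: "g \<in> AP" using AP_uniform_limit[OF qAP g] .
  have "bohr_coeff g l = of_real (\<omega> l) * bohr_coeff f l" for l
  proof (rule LIMSEQ_unique)
    show "(\<lambda>n. bohr_coeff (q n) l) \<longlonglongrightarrow> bohr_coeff g l"
      using tendsto_bohr_coeff_uniform_limit[OF qAP gAP g] .
    show "(\<lambda>n. bohr_coeff (q n) l) \<longlonglongrightarrow> of_real (\<omega> l) * bohr_coeff f l"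
      unfolding q_coeff by (intro tendsto_mult_left tendsto_bohr_coeff_uniform_limit[OF pAP fAP lim])
  qed
  moreover have "cmod (g x) \<le> M" if M: "\<And>x. cmod (f x) \<le> M" for M x
  proof (rule field_le_epsilon)
    fix e :: real assume "e > 0"
    then obtain N where N: "\<And>n x. n \<ge> N \<Longrightarrow> dist (p n x) (f x) < e"
      using lim unfolding uniform_limit_sequentially_iff by (metis UNIV_I)
    have "cmod (q n x) \<le> M + e" if "n \<ge> N" for n
      unfolding q_def
    proof (rule norm_multiplier_trig_poly_le[OF \<omega> p fin order_refl])
      fix y
      show "cmod (p n y) \<le> M + e"
        using N[OF that, of y] M[of y] norm_triangle_sub[of "p n y" "f y"] by (simp add: dist_norm)
    qed
    then show "cmod (g x) \<le> M + e"
      using tendsto_norm[OF tendsto_uniform_limitI[OF g, of x]]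
      by (intro tendsto_upperbound[of _ "cmod (g x)" sequentially]) (auto simp: eventually_sequentially)
  qed
  ultimately show ?thesis using gAP by blast
qed

definition multiplier :: "(real ^ 'n \<Rightarrow> real) \<Rightarrow> (real ^ 'n \<Rightarrow> complex) \<Rightarrow> real ^ 'n \<Rightarrow> complex" where
  "multiplier \<omega> f = (SOME g. g \<in> AP \<and> (\<forall>l. bohr_coeff g l = of_real (\<omega> l) * bohr_coeff f l))"

lemma multiplier_eqI:
  assumes "g \<in> AP" "\<And>l. bohr_coeff g l = of_real (\<omega> l) * bohr_coeff f l"
  shows "multiplier \<omega> f = g"
  unfolding multiplier_def by (rule some_equality) (use assms in \<open>auto intro: AP_eqI\<close>)

context
  fixes D :: "(real ^ 'n) set" and \<omega> :: "real ^ 'n \<Rightarrow> real"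
  assumes \<omega>: "contractive_multiplier D \<omega>"
begin

lemma
  assumes "f \<in> AP_spec D"
  shows multiplier_AP: "multiplier \<omega> f \<in> AP"
    and bohr_coeff_multiplier: "bohr_coeff (multiplier \<omega> f) l = of_real (\<omega> l) * bohr_coeff f l"
    and norm_multiplier_le: "(\<And>x. cmod (f x) \<le> M) \<Longrightarrow> cmod (multiplier \<omega> f x) \<le> M"
proof -
  obtain g where g: "g \<in> AP" "\<And>l. bohr_coeff g l = of_real (\<omega> l) * bohr_coeff f l"
      "\<And>M x. (\<And>x. cmod (f x) \<le> M) \<Longrightarrow> cmod (g x) \<le> M"
    using exists_multiplier[OF \<omega> assms] by blast
  from multiplier_eqI[OF g(1,2)] have "multiplier \<omega> f = g" .
  with g show "multiplier \<omega> f \<in> AP" "bohr_coeff (multiplier \<omega> f) l = of_real (\<omega> l) * bohr_coeff f l"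
      "(\<And>x. cmod (f x) \<le> M) \<Longrightarrow> cmod (multiplier \<omega> f x) \<le> M"
    by auto
qed

lemma multiplier_AP_spec: "f \<in> AP_spec D \<Longrightarrow> multiplier \<omega> f \<in> AP_spec D"
  by (rule AP_specI) (auto simp: multiplier_AP bohr_coeff_multiplier AP_specD)

lemma multiplier_add:
  assumes "f \<in> AP_spec D" "g \<in> AP_spec D"
  shows "multiplier \<omega> (\<lambda>x. f x + g x) = (\<lambda>x. multiplier \<omega> f x + multiplier \<omega> g x)"
  using assms
  by (intro multiplier_eqI AP_add multiplier_AP)
    (auto simp: bohr_coeff_add bohr_coeff_multiplier multiplier_AP AP_specD distrib_left)

lemma multiplier_cmult:
  assumes "f \<in> AP_spec D"
  shows "multiplier \<omega> (\<lambda>x. c * f x) = (\<lambda>x. c * multiplier \<omega> f x)"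
  using assms
  by (intro multiplier_eqI AP_cmult multiplier_AP)
    (auto simp: bohr_coeff_cmult bohr_coeff_multiplier multiplier_AP AP_specD)

lemma multiplier_diff:
  assumes "f \<in> AP_spec D" "g \<in> AP_spec D"
  shows "multiplier \<omega> (\<lambda>x. f x - g x) = (\<lambda>x. multiplier \<omega> f x - multiplier \<omega> g x)"
  using assms
  by (intro multiplier_eqI AP_diff multiplier_AP)
    (auto simp: bohr_coeff_diff bohr_coeff_multiplier multiplier_AP AP_specD right_diff_distrib)

lemma multiplier_uniform_limit:
  assumes "\<And>n. p n \<in> AP_spec D" "f \<in> AP_spec D" "uniform_limit UNIV p f sequentially"
  shows "uniform_limit UNIV (\<lambda>n. multiplier \<omega> (p n)) (multiplier \<omega> f) sequentially"
  unfolding uniform_limit_sequentially_iff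
proof (intro allI impI)
  fix e :: real assume "e > 0"
  then obtain N where N: "\<And>n x. n \<ge> N \<Longrightarrow> dist (p n x) (f x) < e/2"
    using assms(3) unfolding uniform_limit_sequentially_iff by (metis UNIV_I half_gt_zero)
  have "dist (multiplier \<omega> (p n) x) (multiplier \<omega> f x) < e" if "n \<ge> N" for n x
  proof -
    have "cmod (multiplier \<omega> (\<lambda>x. p n x - f x) x) \<le> e/2"
      using N[OF that] by (intro norm_multiplier_le AP_spec_diff assms) (auto simp: dist_norm intro: less_imp_le)
    then show ?thesis using \<open>e > 0\<close> by (simp add: multiplier_diff assms dist_norm)
  qed
  then show "\<exists>N. \<forall>n\<ge>N. \<forall>x\<in>UNIV. dist (multiplier \<omega> (p n) x) (multiplier \<omega> f x) < e" by blast
qed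

end

lemma bohr_coeff_trig_sum_mult:
  assumes "g \<in> AP"
  shows "bohr_coeff (\<lambda>x. trig_sum F c x * g x) l = (\<Sum>m\<in>F. c m * bohr_coeff g (l - m))"
proof -
  have "(\<lambda>x. trig_sum F c x * g x) = (\<lambda>x. \<Sum>m\<in>F. c m * (ap_exp m x * g x))"
    by (simp add: trig_sum_def sum_distrib_right mult.assoc)
  then show ?thesis
    by (simp add: bohr_coeff_sum AP_cmult AP_mult ap_exp_AP assms bohr_coeff_cmult bohr_coeff_ap_exp_mult)
qed

lemma tendsto_bohr_coeff_mult:
  assumes "\<And>n. p n \<in> AP" "f \<in> AP" "uniform_limit UNIV p f sequentially" "g \<in> AP"
  shows "(\<lambda>n. bohr_coeff (\<lambda>x. p n x * g x) l) \<longlonglongrightarrow> bohr_coeff (\<lambda>x. f x * g x) l"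
proof (rule tendsto_bohr_coeff_uniform_limit)
  show "uniform_limit UNIV (\<lambda>n x. p n x * g x) (\<lambda>x. f x * g x) sequentially"
    using assms by (intro uniform_limit_mult_bounded uniform_limit_const AP_bcontfun)
qed (use assms AP_mult in auto)

text \<open>When the first factor is a polynomial, the coefficients of the product are finite convolutions,
  supported in \<open>D + D\<close>; the general case is a limit.\<close>

lemma AP_spec_mult:
  assumes D: "\<And>l m. l \<in> D \<Longrightarrow> m \<in> D \<Longrightarrow> l + m \<in> D"
    and f: "f \<in> AP_spec D" and g: "g \<in> AP_spec D"
  shows "(\<lambda>x. f x * g x) \<in> AP_spec D"
proof (rule AP_specI)
  note fg = AP_specD(1)[OF f] AP_specD(1)[OF g]
  show "(\<lambda>x. f x * g x) \<in> AP" using fg by (rule AP_mult)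
  fix l assume l: "l \<notin> D"
  obtain p where p: "\<And>n. p n \<in> trig_polys D" and lim: "uniform_limit UNIV p f sequentially"
    by (rule AP_spec_approx[OF f]) (rule that)
  have "bohr_coeff (\<lambda>x. p n x * g x) l = 0" for n
  proof -
    obtain F c where F: "F \<subseteq> D" "p n = trig_sum F c" using p[of n] by (auto simp: trig_polys_def)
    have "bohr_coeff g (l - m) = 0" if "m \<in> F" for m
      using D[of m "l - m"] l F(1) that by (intro AP_specD(2)[OF g]) auto
    then show ?thesis by (simp add: F(2) bohr_coeff_trig_sum_mult fg)
  qed
  with tendsto_bohr_coeff_mult[OF trig_polys_AP[OF p] fg(1) lim fg(2), of l]
  show "bohr_coeff (\<lambda>x. f x * g x) l = 0" by (simp add: LIMSEQ_const_iff)
qed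

text \<open>It suffices to compare coefficients, and by continuity in the first factor to do so for a
  polynomial \<open>p\<close>. There both sides are finite convolutions, equal term by term since
  \<open>\<omega> m * \<omega> (l - m) = \<omega> l\<close> whenever \<open>m\<close> and \<open>l - m\<close> are in \<open>D\<close>; for \<open>l - m\<close> outside
  \<open>D\<close> the coefficient of \<open>g\<close> vanishes.\<close>

lemma multiplier_mult:
  assumes D: "\<And>l m. l \<in> D \<Longrightarrow> m \<in> D \<Longrightarrow> l + m \<in> D"
    and \<omega>: "contractive_semicharacter D \<omega>"
    and f: "f \<in> AP_spec D" and g: "g \<in> AP_spec D"
  shows "multiplier \<omega> (\<lambda>x. f x * g x) = (\<lambda>x. multiplier \<omega> f x * multiplier \<omega> g x)"
proof (rule multiplier_eqI)
  have cm: "contractive_multiplier D \<omega>" and hom: "\<And>l m. l \<in> D \<Longrightarrow> m \<in> D \<Longrightarrow> \<omega> (l + m) = \<omega> l * \<omega> m"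
    using \<omega> D unfolding contractive_semicharacter_def by blast+
  note AP = AP_specD(1)[OF f] AP_specD(1)[OF g] multiplier_AP[OF cm f] multiplier_AP[OF cm g]
  show "(\<lambda>x. multiplier \<omega> f x * multiplier \<omega> g x) \<in> AP" using AP(3,4) by (rule AP_mult)
  fix l
  obtain p where p: "\<And>n. p n \<in> trig_polys D" and lim: "uniform_limit UNIV p f sequentially"
    by (rule AP_spec_approx[OF f]) (rule that)
  note pD = trig_polys_AP_spec[OF p]
  have eq: "bohr_coeff (\<lambda>x. multiplier \<omega> (p n) x * multiplier \<omega> g x) l
      = of_real (\<omega> l) * bohr_coeff (\<lambda>x. p n x * g x) l" for n
  proof -
    obtain F c where F: "finite F" "F \<subseteq> D" "p n = trig_sum F c" using p[of n] by (auto simp: trig_polys_def)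
    have Tp: "multiplier \<omega> (p n) = trig_sum F (\<lambda>l. of_real (\<omega> l) * c l)"
      using F(1) by (intro multiplier_eqI trig_sum_AP) (auto simp: F(3) bohr_coeff_trig_sum)
    have terms: "(of_real (\<omega> m) * c m) * (of_real (\<omega> (l - m)) * bohr_coeff g (l - m))
        = of_real (\<omega> l) * (c m * bohr_coeff g (l - m))" if "m \<in> F" for m
    proof (cases "l - m \<in> D")
      case True
      with hom[of m "l - m"] F(2) that show ?thesis by (auto simp: mult_ac)
    qed (simp add: AP_specD(2)[OF g])
    have "bohr_coeff (\<lambda>x. multiplier \<omega> (p n) x * multiplier \<omega> g x) l
        = (\<Sum>m\<in>F. (of_real (\<omega> m) * c m) * (of_real (\<omega> (l - m)) * bohr_coeff g (l - m)))"
      unfolding Tp bohr_coeff_trig_sum_mult[OF AP(4)] bohr_coeff_multiplier[OF cm g] ..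
    also have "\<dots> = of_real (\<omega> l) * (\<Sum>m\<in>F. c m * bohr_coeff g (l - m))"
      unfolding sum_distrib_left using terms by (rule sum.cong[OF refl])
    also have "\<dots> = of_real (\<omega> l) * bohr_coeff (\<lambda>x. p n x * g x) l"
      unfolding F(3) bohr_coeff_trig_sum_mult[OF AP(2)] ..
    finally show ?thesis .
  qed
  show "bohr_coeff (\<lambda>x. multiplier \<omega> f x * multiplier \<omega> g x) l
      = of_real (\<omega> l) * bohr_coeff (\<lambda>x. f x * g x) l"
  proof (rule LIMSEQ_unique)
    show "(\<lambda>n. bohr_coeff (\<lambda>x. multiplier \<omega> (p n) x * multiplier \<omega> g x) l)
        \<longlonglongrightarrow> bohr_coeff (\<lambda>x. multiplier \<omega> f x * multiplier \<omega> g x) l"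
      by (rule tendsto_bohr_coeff_mult[OF multiplier_AP[OF cm pD] AP(3)
            multiplier_uniform_limit[OF cm pD f lim] AP(4)])
    show "(\<lambda>n. bohr_coeff (\<lambda>x. multiplier \<omega> (p n) x * multiplier \<omega> g x) l)
        \<longlonglongrightarrow> of_real (\<omega> l) * bohr_coeff (\<lambda>x. f x * g x) l"
      unfolding eq
      by (intro tendsto_mult_left tendsto_bohr_coeff_mult[OF trig_polys_AP[OF p] AP(1) lim AP(2)])
  qed
qed

section \<open>The Wiener algebra\<close>

lemma wiener_norm_eq: "wiener_norm f = (\<Sum>\<^sub>\<infinity>l. cmod (bohr_coeff f l))"
  unfolding wiener_norm_def by (rule infsum_cong_neutral) (auto simp: bohr_spectrum_def)

lemma APW_iff: "f \<in> APW \<longleftrightarrow> f \<in> AP \<and> (\<lambda>l. cmod (bohr_coeff f l)) summable_on UNIV"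
proof -
  have "(\<lambda>l. cmod (bohr_coeff f l)) summable_on bohr_spectrum f
      \<longleftrightarrow> (\<lambda>l. cmod (bohr_coeff f l)) summable_on UNIV"
    by (rule summable_on_cong_neutral) (auto simp: bohr_spectrum_def)
  then show ?thesis by (simp add: APW_def)
qed

lemma
  assumes "f \<in> AP" "\<And>G. finite G \<Longrightarrow> (\<Sum>l\<in>G. cmod (bohr_coeff f l)) \<le> M"
  shows APWI: "f \<in> APW" and wiener_norm_le: "wiener_norm f \<le> M"
proof -
  have s: "(\<lambda>l. cmod (bohr_coeff f l)) summable_on UNIV"
    using assms(2) by (intro nonneg_bdd_above_summable_on) (auto simp: bdd_above_def)
  then show "f \<in> APW" using assms(1) by (simp add: APW_iff)
  show "wiener_norm f \<le> M"
    unfolding wiener_norm_eq using s assms(2) by (rule infsum_le_finite_sums)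
qed

lemma sum_bohr_coeff_le_wiener_norm:
  assumes "f \<in> APW" "finite G"
  shows "(\<Sum>l\<in>G. cmod (bohr_coeff f l)) \<le> wiener_norm f"
  unfolding wiener_norm_eq using assms by (intro finite_sum_le_infsum) (auto simp: APW_iff)

lemma wiener_norm_nonneg: "wiener_norm f \<ge> 0"
  unfolding wiener_norm_def by (rule infsum_nonneg) simp

lemma APW_AP: "f \<in> APW \<Longrightarrow> f \<in> AP" by (simp add: APW_def)

lemma trig_polys_APW:
  assumes "p \<in> trig_polys D"
  shows "p \<in> APW"
proof -
  have "finite (bohr_spectrum p)" using finite_bohr_spectrum_trig_poly(1)[OF assms] .
  then show ?thesis using trig_polys_AP[OF assms] by (simp add: APW_def)
qed

lemma APW_add:
  assumes "f \<in> APW" "g \<in> APW"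
  shows "(\<lambda>x. f x + g x) \<in> APW"
proof (rule APWI)
  show "(\<lambda>x. f x + g x) \<in> AP" using assms by (intro AP_add APW_AP)
  fix G :: "(real ^ 'a) set" assume G: "finite G"
  have "(\<Sum>l\<in>G. cmod (bohr_coeff (\<lambda>x. f x + g x) l))
      \<le> (\<Sum>l\<in>G. cmod (bohr_coeff f l)) + (\<Sum>l\<in>G. cmod (bohr_coeff g l))"
    unfolding sum.distrib[symmetric]
    by (intro sum_mono) (simp add: bohr_coeff_add APW_AP assms norm_triangle_ineq)
  also have "\<dots> \<le> wiener_norm f + wiener_norm g"
    using assms G by (intro add_mono sum_bohr_coeff_le_wiener_norm)
  finally show "(\<Sum>l\<in>G. cmod (bohr_coeff (\<lambda>x. f x + g x) l)) \<le> wiener_norm f + wiener_norm g" .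
qed

lemma APW_cmult:
  assumes "f \<in> APW"
  shows "(\<lambda>x. c * f x) \<in> APW"
proof (rule APWI)
  show "(\<lambda>x. c * f x) \<in> AP" using assms by (intro AP_cmult APW_AP)
  fix G :: "(real ^ 'a) set" assume G: "finite G"
  have "(\<Sum>l\<in>G. cmod (bohr_coeff (\<lambda>x. c * f x) l)) = cmod c * (\<Sum>l\<in>G. cmod (bohr_coeff f l))"
    by (simp add: bohr_coeff_cmult APW_AP assms norm_mult sum_distrib_left)
  also have "\<dots> \<le> cmod c * wiener_norm f"
    using assms G by (intro mult_left_mono sum_bohr_coeff_le_wiener_norm) auto
  finally show "(\<Sum>l\<in>G. cmod (bohr_coeff (\<lambda>x. c * f x) l)) \<le> cmod c * wiener_norm f" .
qed

text \<open>The estimate \<open>\<parallel>f g\<parallel> \<le> \<parallel>f\<parallel> \<parallel>g\<parallel>\<close> for the Wiener norm is elementary when \<open>f\<close> is a polynomial.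
  The polynomials approximating \<open>f\<close> can be taken with coefficients no larger than those of \<open>f\<close>,
  so the bound for each finite set of frequencies survives the uniform limit.\<close>

lemma APW_mult:
  fixes f g :: "real ^ 'n \<Rightarrow> complex"
  assumes f: "f \<in> APW" and g: "g \<in> APW"
  shows "(\<lambda>x. f x * g x) \<in> APW"
proof (rule APWI)
  note AP = APW_AP[OF f] APW_AP[OF g]
  show "(\<lambda>x. f x * g x) \<in> AP" using AP by (rule AP_mult)
  fix G :: "(real ^ 'n) set" assume G: "finite G"
  obtain p where p: "\<And>n. p n \<in> trig_polys UNIV" and lim: "uniform_limit UNIV p f sequentially"
      and le: "\<And>n l. cmod (bohr_coeff (p n) l) \<le> cmod (bohr_coeff f l)"
    by (rule bochner_fejer_sequence[OF AP(1) subset_UNIV]) (rule that)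
  have "(\<Sum>l\<in>G. cmod (bohr_coeff (\<lambda>x. p n x * g x) l)) \<le> wiener_norm f * wiener_norm g" for n
  proof -
    let ?F = "bohr_spectrum (p n)" and ?c = "bohr_coeff (p n)"
    have fin: "finite ?F" using finite_bohr_spectrum_trig_poly(1)[OF p] .
    have pn: "p n = trig_sum ?F ?c" using trig_polys_eq_trig_sum[OF fin p order_refl] .
    have "bohr_coeff (\<lambda>x. p n x * g x) l = (\<Sum>m\<in>?F. ?c m * bohr_coeff g (l - m))" for l
      by (subst pn) (rule bohr_coeff_trig_sum_mult[OF AP(2)])
    then have "(\<Sum>l\<in>G. cmod (bohr_coeff (\<lambda>x. p n x * g x) l))
        \<le> (\<Sum>l\<in>G. \<Sum>m\<in>?F. cmod (?c m) * cmod (bohr_coeff g (l - m)))"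
      by (intro sum_mono) (auto simp: norm_mult intro!: sum_norm_le)
    also have "\<dots> = (\<Sum>m\<in>?F. cmod (?c m) * (\<Sum>l\<in>G. cmod (bohr_coeff g (l - m))))"
      by (subst sum.swap) (simp add: sum_distrib_left)
    also have "\<dots> \<le> (\<Sum>m\<in>?F. cmod (bohr_coeff f m) * wiener_norm g)"
    proof (intro sum_mono mult_mono le)
      fix m
      have "(\<Sum>l\<in>G. cmod (bohr_coeff g (l - m))) = (\<Sum>l\<in>(\<lambda>l. l - m) ` G. cmod (bohr_coeff g l))"
        by (subst sum.reindex) (auto simp: inj_on_def)
      then show "(\<Sum>l\<in>G. cmod (bohr_coeff g (l - m))) \<le> wiener_norm g"
        using sum_bohr_coeff_le_wiener_norm[OF g, of "(\<lambda>l. l - m) ` G"] G by simp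
    qed (auto intro: sum_nonneg)
    also have "\<dots> \<le> wiener_norm f * wiener_norm g"
      unfolding sum_distrib_right[symmetric]
      by (intro mult_right_mono sum_bohr_coeff_le_wiener_norm[OF f fin] wiener_norm_nonneg)
    finally show ?thesis .
  qed
  moreover have "(\<lambda>n. \<Sum>l\<in>G. cmod (bohr_coeff (\<lambda>x. p n x * g x) l))
      \<longlonglongrightarrow> (\<Sum>l\<in>G. cmod (bohr_coeff (\<lambda>x. f x * g x) l))"
    by (intro tendsto_intros tendsto_bohr_coeff_mult[OF trig_polys_AP[OF p] AP(1) lim AP(2)])
  ultimately show "(\<Sum>l\<in>G. cmod (bohr_coeff (\<lambda>x. f x * g x) l)) \<le> wiener_norm f * wiener_norm g"
    by (intro LIMSEQ_le_const2) auto
qed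

lemma
  assumes \<omega>: "contractive_semicharacter D \<omega>" and f: "f \<in> AP_spec D" "f \<in> APW"
  shows multiplier_APW: "multiplier \<omega> f \<in> APW"
    and wiener_norm_multiplier_le: "wiener_norm (multiplier \<omega> f) \<le> wiener_norm f"
proof -
  have cm: "contractive_multiplier D \<omega>" and b: "\<And>l. l \<in> D \<Longrightarrow> 0 \<le> \<omega> l \<and> \<omega> l \<le> 1"
    using \<omega> unfolding contractive_semicharacter_def by blast+
  have "cmod (bohr_coeff (multiplier \<omega> f) l) \<le> cmod (bohr_coeff f l)" for l
  proof (cases "l \<in> D")
    case True
    then show ?thesis
      using b[OF True] by (simp add: bohr_coeff_multiplier[OF cm f(1)] norm_mult mult_left_le_one_le)
  qed (simp add: bohr_coeff_multiplier[OF cm f(1)] AP_specD(2)[OF f(1)])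
  then have "(\<Sum>l\<in>G. cmod (bohr_coeff (multiplier \<omega> f) l)) \<le> wiener_norm f" if "finite G" for G
    using sum_bohr_coeff_le_wiener_norm[OF f(2) that] sum_mono order_trans by (metis (no_types, lifting))
  with multiplier_AP[OF cm f(1)]
  show "multiplier \<omega> f \<in> APW" "wiener_norm (multiplier \<omega> f) \<le> wiener_norm f"
    using APWI wiener_norm_le by blast+
qed

text \<open>A finite partial sum of the Bohr--Fourier series serves as approximant; the Wiener norm of the
  difference is the tail of a convergent series of absolute values.\<close>

lemma APW_dense:
  assumes "f \<in> AP_spec D" "f \<in> APW" "e > 0"
  shows "\<exists>p\<in>trig_polys D. wiener_norm (\<lambda>x. f x - p x) \<le> e"
proof -
  obtain F where F: "finite F" "dist (\<Sum>l\<in>F. cmod (bohr_coeff f l)) (wiener_norm f) \<le> e"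
    using infsum_finite_approximation[of "\<lambda>l. cmod (bohr_coeff f l)" UNIV e] assms
    by (auto simp: APW_iff wiener_norm_eq)
  let ?F = "F \<inter> D"
  let ?p = "trig_sum ?F (bohr_coeff f)"
  have fin: "finite ?F" using F(1) by simp
  have p: "?p \<in> trig_polys D" using fin by (intro trig_sum_in) auto
  have F_eq: "(\<Sum>l\<in>?F. cmod (bohr_coeff f l)) = (\<Sum>l\<in>F. cmod (bohr_coeff f l))"
    using F(1) assms(1) by (intro sum.mono_neutral_left) (auto simp: AP_specD)
  have coeff: "bohr_coeff (\<lambda>x. f x - ?p x) l = (if l \<in> ?F then 0 else bohr_coeff f l)" for l
    using fin by (simp add: bohr_coeff_diff APW_AP[OF assms(2)] trig_sum_AP bohr_coeff_trig_sum del: Int_iff)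
  have "wiener_norm (\<lambda>x. f x - ?p x) \<le> e"
  proof (rule wiener_norm_le)
    show "(\<lambda>x. f x - ?p x) \<in> AP" using fin by (intro AP_diff APW_AP[OF assms(2)] trig_sum_AP)
    fix G :: "(real ^ 'a) set" assume G: "finite G"
    have "(\<Sum>l\<in>G. cmod (bohr_coeff (\<lambda>x. f x - ?p x) l)) = (\<Sum>l\<in>G - ?F. cmod (bohr_coeff f l))"
      unfolding coeff using G by (intro sum.mono_neutral_cong_right) auto
    also have "\<dots> = (\<Sum>l\<in>G \<union> ?F. cmod (bohr_coeff f l)) - (\<Sum>l\<in>?F. cmod (bohr_coeff f l))"
      using G fin sum_diff[of "G \<union> ?F" ?F "\<lambda>l. cmod (bohr_coeff f l)"] by (simp add: Un_Diff)
    also have "\<dots> \<le> wiener_norm f - (\<Sum>l\<in>F. cmod (bohr_coeff f l))"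
      unfolding F_eq using G F(1) by (intro diff_right_mono sum_bohr_coeff_le_wiener_norm[OF assms(2)]) auto
    also have "\<dots> \<le> e" using F(2) by (simp add: dist_real_def)
    finally show "(\<Sum>l\<in>G. cmod (bohr_coeff (\<lambda>x. f x - ?p x) l)) \<le> e" .
  qed
  with p show ?thesis by blast
qed

section \<open>Characters\<close>

text \<open>The underlying set of the maximal ideal space.\<close>

definition bounded_characters :: "('a \<Rightarrow> complex) set \<Rightarrow> (('a \<Rightarrow> complex) \<Rightarrow> real) \<Rightarrow> (('a \<Rightarrow> complex) \<Rightarrow> complex) set" where
  "bounded_characters A N = dual_space A N \<inter> characters A"

lemma max_ideal_space_eq:
  "max_ideal_space A N = subtopology (product_topology (\<lambda>_. euclidean) A) (bounded_characters A N)"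
  by (simp add: max_ideal_space_def weak_star_topology_def subtopology_subtopology bounded_characters_def)

lemma topspace_max_ideal_space: "topspace (max_ideal_space A N) = bounded_characters A N"
  by (auto simp: max_ideal_space_eq bounded_characters_def characters_def linear_functional_def PiE_UNIV_domain
      PiE_def)

text \<open>What the deformation argument uses of the two algebras. The last assumption expresses that characters
  are contractions; it is verified by a different argument for each norm.\<close>

locale function_algebra =
  fixes D :: "(real ^ 'n) set" and A :: "(real ^ 'n \<Rightarrow> complex) set" and N :: "(real ^ 'n \<Rightarrow> complex) \<Rightarrow> real"
  assumes zero_in: "0 \<in> D" and add_in: "\<And>l m. l \<in> D \<Longrightarrow> m \<in> D \<Longrightarrow> l + m \<in> D"
    and A_AP: "A \<subseteq> AP_spec D" and polys_A: "trig_polys D \<subseteq> A"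
    and A_add: "\<And>f g. f \<in> A \<Longrightarrow> g \<in> A \<Longrightarrow> (\<lambda>x. f x + g x) \<in> A"
    and A_cmult: "\<And>c f. f \<in> A \<Longrightarrow> (\<lambda>x. c * f x) \<in> A"
    and A_mult: "\<And>f g. f \<in> A \<Longrightarrow> g \<in> A \<Longrightarrow> (\<lambda>x. f x * g x) \<in> A"
    and multiplier_A: "\<And>\<omega> f. contractive_semicharacter D \<omega> \<Longrightarrow> f \<in> A \<Longrightarrow> multiplier \<omega> f \<in> A"
    and N_multiplier: "\<And>\<omega> f. contractive_semicharacter D \<omega> \<Longrightarrow> f \<in> A \<Longrightarrow> N (multiplier \<omega> f) \<le> N f"
    and polys_dense: "\<And>f e. f \<in> A \<Longrightarrow> 0 < e \<Longrightarrow> \<exists>p\<in>trig_polys D. N (\<lambda>x. f x - p x) \<le> e"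
    and character_le: "\<And>\<phi> f. \<phi> \<in> bounded_characters A N \<Longrightarrow> f \<in> A \<Longrightarrow> cmod (\<phi> f) \<le> N f"
begin

lemma A_diff: "f \<in> A \<Longrightarrow> g \<in> A \<Longrightarrow> (\<lambda>x. f x - g x) \<in> A"
  using A_add[of f "\<lambda>x. -1 * g x"] A_cmult[of g "-1"] by simp

lemma A_exp: "l \<in> D \<Longrightarrow> ap_exp l \<in> A"
  using polys_A ap_exp_in_trig_polys by blast

lemma A_spec: "f \<in> A \<Longrightarrow> f \<in> AP_spec D" using A_AP by blast

lemma
  assumes "\<phi> \<in> bounded_characters A N"
  shows character_extensional: "\<phi> \<in> extensional A"
    and character_add: "\<And>f g. f \<in> A \<Longrightarrow> g \<in> A \<Longrightarrow> \<phi> (\<lambda>x. f x + g x) = \<phi> f + \<phi> g"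
    and character_cmult: "\<And>c f. f \<in> A \<Longrightarrow> \<phi> (\<lambda>x. c * f x) = c * \<phi> f"
    and character_mult: "\<And>f g. f \<in> A \<Longrightarrow> g \<in> A \<Longrightarrow> \<phi> (\<lambda>x. f x * g x) = \<phi> f * \<phi> g"
  using assms unfolding bounded_characters_def characters_def linear_functional_def by blast+

lemma character_one:
  assumes "\<phi> \<in> bounded_characters A N"
  shows "\<phi> (\<lambda>x. 1) = 1"
proof -
  obtain f where f: "f \<in> A" "\<phi> f \<noteq> 0"
    using assms unfolding bounded_characters_def characters_def by blast
  have "\<phi> (\<lambda>x. 1 * f x) = \<phi> (\<lambda>x. 1) * \<phi> f"
    using A_exp[OF zero_in] by (intro character_mult[OF assms]) (auto simp: f)
  with f show ?thesis by simp
qed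

lemma character_diff:
  assumes "\<phi> \<in> bounded_characters A N" "f \<in> A" "g \<in> A"
  shows "\<phi> (\<lambda>x. f x - g x) = \<phi> f - \<phi> g"
  using character_add[OF assms(1,2) A_cmult[OF assms(3), of "-1"]] character_cmult[OF assms(1,3), of "-1"]
  by simp

lemma character_trig_sum:
  assumes "\<phi> \<in> bounded_characters A N" "finite F" "F \<subseteq> D"
  shows "\<phi> (trig_sum F c) = (\<Sum>l\<in>F. c l * \<phi> (ap_exp l))"
  using assms(2,3)
proof (induction F)
  case empty
  have "\<phi> (\<lambda>x. 0 * ap_exp 0 x) = 0 * \<phi> (ap_exp 0)"
    using A_exp[OF zero_in] by (intro character_cmult[OF assms(1)]) simp
  then show ?case by (simp add: trig_sum_def)
next
  case (insert l F)
  have "trig_sum (insert l F) c = (\<lambda>x. c l * ap_exp l x + trig_sum F c x)"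
    using insert by (simp add: trig_sum_def)
  moreover have "trig_sum F c \<in> A" using insert polys_A trig_sum_in by blast
  ultimately show ?case
    using insert character_add[OF assms(1) A_cmult[OF A_exp]] character_cmult[OF assms(1) A_exp]
    by simp
qed

text \<open>Composition with the multiplier, made \<^const>\<open>undefined\<close> outside \<open>A\<close> as functionals
  are required to be.\<close>

definition pull_back :: "(real ^ 'n \<Rightarrow> real) \<Rightarrow> ((real ^ 'n \<Rightarrow> complex) \<Rightarrow> complex) \<Rightarrow> (real ^ 'n \<Rightarrow> complex) \<Rightarrow> complex" where
  "pull_back \<omega> \<phi> = restrict (\<lambda>f. \<phi> (multiplier \<omega> f)) A"

lemma pull_back_character:
  assumes \<omega>: "contractive_semicharacter D \<omega>" and \<phi>: "\<phi> \<in> bounded_characters A N"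
  shows "pull_back \<omega> \<phi> \<in> bounded_characters A N"
proof -
  have cm: "contractive_multiplier D \<omega>" and "\<omega> 0 = 1"
    using \<omega> unfolding contractive_semicharacter_def by blast+
  note T = multiplier_A[OF \<omega>]
  have lin: "linear_functional A (pull_back \<omega> \<phi>)"
    unfolding linear_functional_def pull_back_def
    by (auto simp: A_add A_cmult A_spec multiplier_add[OF cm] multiplier_cmult[OF cm]
        character_add[OF \<phi>] character_cmult[OF \<phi>] T)
  moreover have "pull_back \<omega> \<phi> (\<lambda>x. f x * g x) = pull_back \<omega> \<phi> f * pull_back \<omega> \<phi> g" if "f \<in> A" "g \<in> A" for f g
    using that by (simp add: pull_back_def A_mult A_spec multiplier_mult[OF add_in \<omega>] character_mult[OF \<phi>] T)
  moreover have "\<exists>f\<in>A. pull_back \<omega> \<phi> f \<noteq> 0"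
  proof
    have "multiplier \<omega> (ap_exp 0) = ap_exp 0"
      using \<open>\<omega> 0 = 1\<close> by (intro multiplier_eqI ap_exp_AP) (auto simp: bohr_coeff_ap_exp simp del: ap_exp_0)
    then show "pull_back \<omega> \<phi> (ap_exp 0) \<noteq> 0"
      using A_exp[OF zero_in] by (simp add: pull_back_def character_one[OF \<phi>])
    show "ap_exp 0 \<in> A" using A_exp[OF zero_in] .
  qed
  moreover have "cmod (pull_back \<omega> \<phi> f) \<le> 1 * N f" if "f \<in> A" for f
    using character_le[OF \<phi> T[OF that]] N_multiplier[OF \<omega> that] that by (simp add: pull_back_def)
  ultimately show ?thesis
    unfolding bounded_characters_def characters_def dual_space_def by blast
qed

text \<open>The homotopy sends \<open>(t, \<phi>)\<close> to \<open>\<phi>\<close> composed with the multiplier of \<open>\<omega> t\<close>. In the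
  weak-* topology, continuity has to be checked for evaluation at one \<open>f\<close> at a time. If \<open>f\<close> is a
  polynomial with coefficients \<open>c\<close>, the value is the finite sum of \<open>\<omega> t l * c l * \<phi> e\<^sub>l\<close>, which
  is jointly continuous. In general it is a limit of such functions, uniformly in \<open>t\<close> and \<open>\<phi>\<close>
  because characters and multipliers are contractions. At \<open>t = 1\<close> only the mean of \<open>f\<close> remains,
  a constant function, on which all characters agree.\<close>

theorem contractible_max_ideal_space:
  assumes path: "contracting_path D \<omega>"
  shows "contractible_space (max_ideal_space A N)"
proof -
  let ?M = "bounded_characters A N" and ?X = "max_ideal_space A N"
  let ?Z = "prod_topology (top_of_set {0..1::real}) ?X"
  let ?H = "\<lambda>(t, \<phi>). pull_back (\<omega> t) \<phi>"
  have semi: "\<And>t. t \<in> {0..1} \<Longrightarrow> contractive_semicharacter D (\<omega> t)"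
    and cont: "\<And>l. l \<in> D \<Longrightarrow> continuous_on {0..1} (\<lambda>t. \<omega> t l)"
    and start: "\<And>l. l \<in> D \<Longrightarrow> \<omega> 0 l = 1" and stop: "\<And>l. l \<in> D \<Longrightarrow> \<omega> 1 l = (if l = 0 then 1 else 0)"
    using path unfolding contracting_path_def by blast+
  have cm: "contractive_multiplier D (\<omega> t)" if "t \<in> {0..1}" for t
    using semi[OF that] unfolding contractive_semicharacter_def by blast
  have topZ: "topspace ?Z = {0..1} \<times> ?M" by (simp add: topspace_max_ideal_space)
  have eval: "continuous_map ?X euclidean (\<lambda>\<phi>. \<phi> f)" if "f \<in> A" for f
    unfolding max_ideal_space_eq
    by (rule continuous_map_from_subtopology[OF continuous_map_product_projection[OF that]])
  have poly: "continuous_map ?Z euclidean (\<lambda>(t, \<phi>). \<phi> (multiplier (\<omega> t) p))" if p: "p \<in> trig_polys D" for p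
  proof -
    obtain F c where F: "finite F" "F \<subseteq> D" "p = trig_sum F c" using p by (auto simp: trig_polys_def)
    have term_cont: "continuous_map ?Z euclidean (\<lambda>z. of_real (\<omega> (fst z) l) * c l * (snd z) (ap_exp l))"
      if l: "l \<in> F" for l
    proof -
      have "l \<in> D" using l F(2) by blast
      have "continuous_map (top_of_set {0..1::real}) euclidean (\<lambda>t. \<omega> t l)"
        using cont[OF \<open>l \<in> D\<close>] by simp
      from continuous_map_compose[OF continuous_map_fst this, of ?X]
      have 1: "continuous_map ?Z euclidean (\<lambda>z. \<omega> (fst z) l)" by (simp add: o_def)
      from continuous_map_compose[OF continuous_map_snd eval[OF A_exp[OF \<open>l \<in> D\<close>]], of "top_of_set {0..1::real}"]
      have 2: "continuous_map ?Z euclidean (\<lambda>z. (snd z) (ap_exp l))" by (simp add: o_def)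
      show ?thesis
        using 1 2 unfolding continuous_map_atin limitin_canonical_iff by (auto intro!: tendsto_intros)
    qed
    have "continuous_map ?Z euclidean (\<lambda>z. \<Sum>l\<in>F. of_real (\<omega> (fst z) l) * c l * (snd z) (ap_exp l))"
      using F(1) term_cont by (rule continuous_map_sum)
    then show ?thesis
    proof (rule continuous_map_eq)
      fix z assume "z \<in> topspace ?Z"
      then have "z \<in> {0..1} \<times> ?M" unfolding topZ .
      then obtain t \<phi> where z: "z = (t, \<phi>)" "t \<in> {0..1}" "\<phi> \<in> ?M" by (rule SigmaE)
      have "multiplier (\<omega> t) p = trig_sum F (\<lambda>l. of_real (\<omega> t l) * c l)"
        using F(1) by (intro multiplier_eqI trig_sum_AP) (auto simp: F(3) bohr_coeff_trig_sum)
      with z F show "(\<Sum>l\<in>F. of_real (\<omega> (fst z) l) * c l * (snd z) (ap_exp l))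
          = (case z of (t, \<phi>) \<Rightarrow> \<phi> (multiplier (\<omega> t) p))"
        by (simp add: character_trig_sum)
    qed
  qed
  have comp: "continuous_map ?Z euclidean (\<lambda>(t, \<phi>). \<phi> (multiplier (\<omega> t) f))" if f: "f \<in> A" for f
  proof -
    have "\<exists>p\<in>trig_polys D. N (\<lambda>x. f x - p x) \<le> inverse (real (Suc n))" for n
      using f by (intro polys_dense) auto
    then obtain p where p: "\<And>n. p n \<in> trig_polys D" and Np: "\<And>n. N (\<lambda>x. f x - p n x) \<le> inverse (real (Suc n))"
      by metis
    have pA: "p n \<in> A" for n using p polys_A by blast
    have "continuous_map ?Z Met_TC.mtopology (\<lambda>(t, \<phi>). \<phi> (multiplier (\<omega> t) f))"
    proof (rule Met_TC.continuous_map_uniform_limit[where F = sequentially])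
      show "\<forall>\<^sub>F n in sequentially. continuous_map ?Z Met_TC.mtopology (\<lambda>(t, \<phi>). \<phi> (multiplier (\<omega> t) (p n)))"
        using poly[OF p] by simp
      fix e :: real assume "e > 0"
      have "\<forall>\<^sub>F n in sequentially. inverse (real (Suc n)) < e"
        using order_tendstoD(2)[OF LIMSEQ_inverse_real_of_nat \<open>e > 0\<close>] .
      then show "\<forall>\<^sub>F n in sequentially. \<forall>z\<in>topspace ?Z. (case z of (t, \<phi>) \<Rightarrow> \<phi> (multiplier (\<omega> t) f)) \<in> UNIV \<and>
          dist (case z of (t, \<phi>) \<Rightarrow> \<phi> (multiplier (\<omega> t) (p n))) (case z of (t, \<phi>) \<Rightarrow> \<phi> (multiplier (\<omega> t) f)) < e"
      proof eventually_elim
        case (elim n)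
        have "dist (\<phi> (multiplier (\<omega> t) (p n))) (\<phi> (multiplier (\<omega> t) f)) < e"
          if t: "t \<in> {0..1}" and \<phi>: "\<phi> \<in> ?M" for t \<phi>
        proof -
          note T = multiplier_A[OF semi[OF t]]
          have "\<phi> (multiplier (\<omega> t) f) - \<phi> (multiplier (\<omega> t) (p n)) = \<phi> (multiplier (\<omega> t) (\<lambda>x. f x - p n x))"
            by (simp add: multiplier_diff[OF cm[OF t]] A_spec f pA character_diff[OF \<phi>] T)
          also have "cmod \<dots> \<le> N (multiplier (\<omega> t) (\<lambda>x. f x - p n x))"
            by (intro character_le[OF \<phi>] T A_diff f pA)
          also have "\<dots> \<le> N (\<lambda>x. f x - p n x)"
            by (intro N_multiplier semi t A_diff f pA)
          also have "\<dots> < e" using Np[of n] elim by simp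
          finally show ?thesis by (simp add: dist_norm norm_minus_commute)
        qed
        then show ?case unfolding topZ by auto
      qed
    qed simp
    then show ?thesis by simp
  qed
  have cont_H: "continuous_map ?Z ?X ?H"
    unfolding max_ideal_space_eq[of A N] continuous_map_in_subtopology
  proof
    have "continuous_map ?Z (product_topology (\<lambda>_. euclidean) A) ?H"
      unfolding continuous_map_componentwise
    proof (intro conjI ballI)
      show "?H ` topspace ?Z \<subseteq> extensional A"
        by (auto simp: pull_back_def)
      fix f assume f: "f \<in> A"
      have "(\<lambda>z. (case z of (t, \<phi>) \<Rightarrow> pull_back (\<omega> t) \<phi>) f) = (\<lambda>(t, \<phi>). \<phi> (multiplier (\<omega> t) f))"
        using f by (auto simp: pull_back_def)
      with comp[OF f] show "continuous_map ?Z euclidean (\<lambda>z. (case z of (t, \<phi>) \<Rightarrow> pull_back (\<omega> t) \<phi>) f)"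
        by simp
    qed
    then show "continuous_map (prod_topology (top_of_set {0..1::real})
        (subtopology (product_topology (\<lambda>_. euclidean) A) ?M)) (product_topology (\<lambda>_. euclidean) A) ?H"
      by (simp add: max_ideal_space_eq)
    show "?H \<in> topspace (prod_topology (top_of_set {0..1::real})
        (subtopology (product_topology (\<lambda>_. euclidean) A) ?M)) \<rightarrow> ?M"
      unfolding max_ideal_space_eq[symmetric] topZ using pull_back_character semi by auto
  qed
  let ?a = "restrict (\<lambda>f. bohr_coeff f 0) A"
  have at_0: "pull_back (\<omega> 0) \<phi> = \<phi>" if \<phi>: "\<phi> \<in> ?M" for \<phi>
  proof (rule extensionalityI[of _ A])
    show "pull_back (\<omega> 0) \<phi> \<in> extensional A" by (simp add: pull_back_def)
    show "\<phi> \<in> extensional A" using character_extensional[OF \<phi>] .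
    fix f assume f: "f \<in> A"
    have "multiplier (\<omega> 0) f = f"
    proof (rule multiplier_eqI)
      show "f \<in> AP" using AP_specD(1)[OF A_spec[OF f]] .
      show "bohr_coeff f l = of_real (\<omega> 0 l) * bohr_coeff f l" for l
        using start[of l] AP_specD(2)[OF A_spec[OF f], of l] by (cases "l \<in> D") auto
    qed
    then show "pull_back (\<omega> 0) \<phi> f = \<phi> f" using f by (simp add: pull_back_def)
  qed
  have at_1: "pull_back (\<omega> 1) \<phi> = ?a" if \<phi>: "\<phi> \<in> ?M" for \<phi>
  proof (rule extensionalityI[of _ A])
    fix f assume f: "f \<in> A"
    have "multiplier (\<omega> 1) f = (\<lambda>x. bohr_coeff f 0 * ap_exp 0 x)"
    proof (rule multiplier_eqI)
      show "(\<lambda>x. bohr_coeff f 0 * ap_exp 0 x) \<in> AP" by (intro AP_cmult ap_exp_AP)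
      show "bohr_coeff (\<lambda>x. bohr_coeff f 0 * ap_exp 0 x) l = of_real (\<omega> 1 l) * bohr_coeff f l" for l
        unfolding bohr_coeff_cmult[OF ap_exp_AP] bohr_coeff_ap_exp
        using stop[of l] AP_specD(2)[OF A_spec[OF f], of l] by (cases "l \<in> D") auto
    qed
    then show "pull_back (\<omega> 1) \<phi> f = ?a f"
      using f character_cmult[OF \<phi> A_exp[OF zero_in]] by (simp add: pull_back_def character_one[OF \<phi>])
  qed (auto simp: pull_back_def)
  have "homotopic_with (\<lambda>x. True) ?X ?X id (\<lambda>_. ?a)"
    unfolding homotopic_with[of ?X "\<lambda>_. True", OF refl]
    using cont_H at_0 at_1 by (intro exI[of _ ?H]) (auto simp: topspace_max_ideal_space)
  then show ?thesis unfolding contractible_space_def by blast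
qed

end

text \<open>The constant depends on \<open>\<phi>\<close> and may be far from 1; it is made nonnegative here so that it can
  be used in chains of inequalities.\<close>

lemma bounded_charactersD:
  assumes "\<phi> \<in> bounded_characters A N"
  obtains C where "C \<ge> 0" "\<And>f. f \<in> A \<Longrightarrow> N f \<ge> 0 \<Longrightarrow> cmod (\<phi> f) \<le> C * N f"
proof -
  obtain C where C: "\<And>f. f \<in> A \<Longrightarrow> cmod (\<phi> f) \<le> C * N f"
    using assms unfolding bounded_characters_def dual_space_def by blast
  show thesis
  proof (rule that[of "\<bar>C\<bar>"])
    show "cmod (\<phi> f) \<le> \<bar>C\<bar> * N f" if "f \<in> A" "N f \<ge> 0" for f
      using C[OF that(1)] mult_right_mono[OF abs_ge_self[of C] that(2)] by linarith
  qed simp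
qed

lemma norm_le_sup_norm:
  assumes "f \<in> bcontfun"
  shows "cmod (f x) \<le> sup_norm f"
proof -
  obtain B where "\<And>x. cmod (f x) \<le> B"
    by (rule bcontfun_bounded[OF assms]) (rule that)
  then have "bdd_above (range (\<lambda>x. cmod (f x)))" by (intro bdd_aboveI2)
  then show ?thesis unfolding sup_norm_def by (rule cSUP_upper[OF UNIV_I])
qed

lemma sup_norm_le: "(\<And>x. cmod (f x) \<le> M) \<Longrightarrow> sup_norm f \<le> M"
  unfolding sup_norm_def by (rule cSUP_least) auto

lemma sup_norm_nonneg: "f \<in> bcontfun \<Longrightarrow> sup_norm f \<ge> 0"
  by (rule order_trans[OF norm_ge_zero norm_le_sup_norm])

text \<open>A bounded character satisfies \<open>|\<phi> f|\<^sup>n = |\<phi> (f\<^sup>n)| \<le> C \<parallel>f\<parallel>\<^sup>n\<close> for every \<open>n\<close>, hence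
  \<open>|\<phi> f| \<le> \<parallel>f\<parallel>\<close>.\<close>

lemma function_algebra_AP_spec:
  fixes D :: "(real ^ 'n) set"
  assumes "0 \<in> D" "\<And>l m. l \<in> D \<Longrightarrow> m \<in> D \<Longrightarrow> l + m \<in> D"
  shows "function_algebra D (AP_spec D) sup_norm"
proof
  show "0 \<in> D" "\<And>l m. l \<in> D \<Longrightarrow> m \<in> D \<Longrightarrow> l + m \<in> D" by fact+
  show mult: "(\<lambda>x. f x * g x) \<in> AP_spec D" if "f \<in> AP_spec D" "g \<in> AP_spec D" for f g
    using assms(2) that by (rule AP_spec_mult)
  show "trig_polys D \<subseteq> AP_spec D" using trig_polys_AP_spec by blast
  have bc: "f \<in> bcontfun" if "f \<in> AP_spec D" for f using AP_bcontfun[OF AP_specD(1)[OF that]] .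
  fix \<omega> f assume \<omega>: "contractive_semicharacter D \<omega>" and f: "f \<in> AP_spec D"
  then have cm: "contractive_multiplier D \<omega>" unfolding contractive_semicharacter_def by blast
  show "multiplier \<omega> f \<in> AP_spec D" using multiplier_AP_spec[OF cm f] .
  show "sup_norm (multiplier \<omega> f) \<le> sup_norm f"
    by (intro sup_norm_le norm_multiplier_le[OF cm f] norm_le_sup_norm bc f)
next
  fix f :: "real ^ 'n \<Rightarrow> complex" and e :: real assume f: "f \<in> AP_spec D" and "e > 0"
  then obtain p where p: "p \<in> trig_polys (bohr_spectrum f)" "\<forall>x. cmod (f x - p x) < e"
    using bochner_fejer[OF AP_specD(1)[OF f]] by blast
  have "p \<in> trig_polys D"
    using p(1) f unfolding AP_spec_def trig_polys_def by blast
  moreover have "sup_norm (\<lambda>x. f x - p x) \<le> e" using p(2) by (intro sup_norm_le) (simp add: less_imp_le)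
  ultimately show "\<exists>p\<in>trig_polys D. sup_norm (\<lambda>x. f x - p x) \<le> e" by blast
next
  fix \<phi> and f :: "real ^ 'n \<Rightarrow> complex"
  assume \<phi>: "\<phi> \<in> bounded_characters (AP_spec D) sup_norm" and f: "f \<in> AP_spec D"
  have bc: "f \<in> bcontfun" if "f \<in> AP_spec D" for f :: "real ^ 'n \<Rightarrow> complex"
    using AP_bcontfun[OF AP_specD(1)[OF that]] .
  have one: "(\<lambda>x. 1) \<in> AP_spec D"
    using trig_polys_AP_spec[OF ap_exp_in_trig_polys[OF assms(1)]] by simp
  have mult: "\<phi> (\<lambda>x. g x * h x) = \<phi> g * \<phi> h" if "g \<in> AP_spec D" "h \<in> AP_spec D" for g h
    using \<phi> that unfolding bounded_characters_def characters_def by blast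
  obtain C where C: "C \<ge> 0" "\<And>g. g \<in> AP_spec D \<Longrightarrow> sup_norm g \<ge> 0 \<Longrightarrow> cmod (\<phi> g) \<le> C * sup_norm g"
    by (rule bounded_charactersD[OF \<phi>]) (rule that)
  have pow: "(\<lambda>x. f x ^ Suc n) \<in> AP_spec D \<and> \<phi> (\<lambda>x. f x ^ Suc n) = \<phi> f ^ Suc n" for n
  proof (induction n)
    case (Suc n)
    then show ?case
      using AP_spec_mult[OF assms(2) f, of "\<lambda>x. f x ^ Suc n"] mult[OF f, of "\<lambda>x. f x ^ Suc n"] by simp
  qed (use f in simp)
  show "cmod (\<phi> f) \<le> sup_norm f"
  proof (rule le_if_powers_le[where C = "max 1 C"])
    show "0 \<le> sup_norm f" using sup_norm_nonneg[OF bc[OF f]] .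
    show "cmod (\<phi> f) ^ n \<le> max 1 C * sup_norm f ^ n" for n
    proof (cases n)
      case (Suc k)
      let ?g = "\<lambda>x. f x ^ n"
      have g: "?g \<in> AP_spec D" "\<phi> ?g = \<phi> f ^ n" using pow[of k] Suc by auto
      have "cmod (\<phi> f) ^ n = cmod (\<phi> ?g)" by (simp add: g norm_power)
      also have "\<dots> \<le> C * sup_norm ?g" using sup_norm_nonneg[OF bc[OF g(1)]] by (intro C g)
      also have "\<dots> \<le> max 1 C * sup_norm f ^ n"
        using norm_le_sup_norm[OF bc[OF f]] sup_norm_nonneg[OF bc[OF g(1)]]
        by (intro mult_mono sup_norm_le) (auto simp: norm_power power_mono)
      finally show ?thesis .
    qed simp
  qed simp
qed (auto intro: AP_spec_add AP_spec_cmult)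

lemma wiener_norm_ap_exp: "wiener_norm (ap_exp l) \<le> 1"
proof (rule wiener_norm_le[OF ap_exp_AP])
  fix G :: "(real ^ 'a) set" assume "finite G"
  then show "(\<Sum>m\<in>G. cmod (bohr_coeff (ap_exp l) m)) \<le> 1"
    by (simp add: bohr_coeff_ap_exp if_distrib[of cmod] cong: if_cong)
qed

text \<open>All powers of an exponential are exponentials and have norm 1, so a bounded character has absolute
  value at most 1 on each of them. Summing up, \<open>|\<phi> p|\<close> is at most the sum of the absolute values
  of the coefficients of a polynomial \<open>p\<close>, and this extends to the whole algebra by density and
  boundedness of \<open>\<phi>\<close>.\<close>

lemma function_algebra_APW_spec:
  fixes D :: "(real ^ 'n) set"
  assumes "0 \<in> D" "\<And>l m. l \<in> D \<Longrightarrow> m \<in> D \<Longrightarrow> l + m \<in> D"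
  shows "function_algebra D (APW_spec D) wiener_norm"
proof
  have iff: "f \<in> APW_spec D \<longleftrightarrow> f \<in> AP_spec D \<and> f \<in> APW" for f
    by (auto simp: APW_spec_def AP_spec_def APW_AP)
  show "0 \<in> D" "\<And>l m. l \<in> D \<Longrightarrow> m \<in> D \<Longrightarrow> l + m \<in> D" by fact+
  show "APW_spec D \<subseteq> AP_spec D" using iff by blast
  show polys: "trig_polys D \<subseteq> APW_spec D"
    using trig_polys_AP_spec trig_polys_APW iff by blast
  show add: "(\<lambda>x. f x + g x) \<in> APW_spec D" if "f \<in> APW_spec D" "g \<in> APW_spec D" for f g
    using that unfolding iff by (simp add: AP_spec_add APW_add)
  show cmult: "(\<lambda>x. c * f x) \<in> APW_spec D" if "f \<in> APW_spec D" for c f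
    using that unfolding iff by (simp add: AP_spec_cmult APW_cmult)
  show "(\<lambda>x. f x * g x) \<in> APW_spec D" if "f \<in> APW_spec D" "g \<in> APW_spec D" for f g
    using that AP_spec_mult[OF assms(2)] APW_mult unfolding iff by blast
  show "multiplier \<omega> f \<in> APW_spec D" "wiener_norm (multiplier \<omega> f) \<le> wiener_norm f"
    if \<omega>: "contractive_semicharacter D \<omega>" and f: "f \<in> APW_spec D" for \<omega> f
  proof -
    have "contractive_multiplier D \<omega>" using \<omega> unfolding contractive_semicharacter_def by blast
    with f \<omega> show "multiplier \<omega> f \<in> APW_spec D" "wiener_norm (multiplier \<omega> f) \<le> wiener_norm f"
      unfolding iff using multiplier_AP_spec multiplier_APW wiener_norm_multiplier_le by blast+
  qed
  show dense: "\<exists>p\<in>trig_polys D. wiener_norm (\<lambda>x. f x - p x) \<le> e" if "f \<in> APW_spec D" "0 < e" for f e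
    using that unfolding iff by (intro APW_dense) auto
  fix \<phi> and f :: "real ^ 'n \<Rightarrow> complex"
  assume \<phi>: "\<phi> \<in> bounded_characters (APW_spec D) wiener_norm" and f: "f \<in> APW_spec D"
  have add_\<phi>: "\<phi> (\<lambda>x. g x + h x) = \<phi> g + \<phi> h" and mult_\<phi>: "\<phi> (\<lambda>x. g x * h x) = \<phi> g * \<phi> h"
    if "g \<in> APW_spec D" "h \<in> APW_spec D" for g h
    using \<phi> that unfolding bounded_characters_def characters_def linear_functional_def by blast+
  have cmult_\<phi>: "\<phi> (\<lambda>x. c * g x) = c * \<phi> g" if "g \<in> APW_spec D" for c g
    using \<phi> that unfolding bounded_characters_def characters_def linear_functional_def by blast
  obtain C where C: "C \<ge> 0" "\<And>g. g \<in> APW_spec D \<Longrightarrow> wiener_norm g \<ge> 0 \<Longrightarrow> cmod (\<phi> g) \<le> C * wiener_norm g"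
    by (rule bounded_charactersD[OF \<phi>]) (rule that)
  have exp_le: "cmod (\<phi> (ap_exp l)) \<le> 1" if l: "l \<in> D" for l
  proof (rule le_if_powers_le[where C = "max 1 C"])
    have e: "ap_exp m \<in> APW_spec D" if "m \<in> D" for m using ap_exp_in_trig_polys[OF that] polys by blast
    have pow: "\<exists>m\<in>D. \<phi> (ap_exp m) = \<phi> (ap_exp l) ^ Suc n" for n
    proof (induction n)
      case (Suc n)
      then obtain m where m: "m \<in> D" "\<phi> (ap_exp m) = \<phi> (ap_exp l) ^ Suc n" by blast
      have "\<phi> (ap_exp (l + m)) = \<phi> (ap_exp l) * \<phi> (ap_exp m)"
        using mult_\<phi>[OF e[OF l] e[OF m(1)]] by (simp flip: ap_exp_add)
      with m assms(2)[OF l m(1)] show ?case by (intro bexI[of _ "l + m"]) auto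
    qed (use l in auto)
    show "cmod (\<phi> (ap_exp l)) ^ n \<le> max 1 C * 1 ^ n" for n
    proof (cases n)
      case (Suc k)
      obtain m where m: "m \<in> D" "\<phi> (ap_exp m) = \<phi> (ap_exp l) ^ n" using pow[of k] Suc by blast
      have "cmod (\<phi> (ap_exp l)) ^ n = cmod (\<phi> (ap_exp m))" by (simp add: m norm_power)
      also have "\<dots> \<le> C * wiener_norm (ap_exp m)" by (intro C e m wiener_norm_nonneg)
      also have "\<dots> \<le> C * 1" using C(1) by (intro mult_left_mono wiener_norm_ap_exp)
      finally show ?thesis by simp
    qed simp
  qed auto
  have poly_le: "cmod (\<phi> (trig_sum F c)) \<le> (\<Sum>l\<in>F. cmod (c l))" if "finite F" "F \<subseteq> D" for F c
    using that
  proof (induction F)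
    case empty
    have "(\<lambda>x. 0 * f x) = trig_sum {} c" by (simp add: trig_sum_def)
    with cmult_\<phi>[OF f, of 0] show ?case by simp
  next
    case (insert l F)
    have e: "ap_exp l \<in> APW_spec D" using ap_exp_in_trig_polys[of l D] polys insert by blast
    have t: "trig_sum F c \<in> APW_spec D" using trig_sum_in[of F D] polys insert by blast
    have "trig_sum (insert l F) c = (\<lambda>x. c l * ap_exp l x + trig_sum F c x)"
      using insert by (simp add: trig_sum_def)
    then have "\<phi> (trig_sum (insert l F) c) = c l * \<phi> (ap_exp l) + \<phi> (trig_sum F c)"
      by (simp add: add_\<phi>[OF cmult[OF e] t] cmult_\<phi>[OF e])
    also have "cmod \<dots> \<le> cmod (c l) * cmod (\<phi> (ap_exp l)) + cmod (\<phi> (trig_sum F c))"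
      by (metis norm_mult norm_triangle_ineq)
    also have "\<dots> \<le> cmod (c l) * 1 + (\<Sum>l\<in>F. cmod (c l))"
      using insert exp_le by (intro add_mono mult_left_mono) auto
    finally show ?case using insert by simp
  qed
  show "cmod (\<phi> f) \<le> wiener_norm f"
  proof (rule field_le_epsilon)
    fix e :: real assume "e > 0"
    \<comment> \<open>Replacing \<open>f\<close> by \<open>p\<close> costs \<open>C * d\<close> in the value of \<open>\<phi>\<close> and \<open>d\<close> in the norm.\<close>
    define d where "d = e / (C + 1)"
    have d: "d > 0" "(C + 1) * d = e" using C(1) \<open>e > 0\<close> by (auto simp: d_def)
    obtain p where p: "p \<in> trig_polys D" "wiener_norm (\<lambda>x. f x - p x) \<le> d"
      using dense[OF f d(1)] by blast
    let ?F = "bohr_spectrum p" and ?h = "\<lambda>x. f x - p x"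
    have F: "finite ?F" "?F \<subseteq> D" using finite_bohr_spectrum_trig_poly[OF p(1)] .
    have pA: "p \<in> APW_spec D" using p(1) polys by blast
    have hA: "?h \<in> APW_spec D" using add[OF f cmult[OF pA, of "-1"]] by simp
    have "cmod (bohr_coeff p l) \<le> cmod (bohr_coeff f l) + cmod (bohr_coeff ?h l)" for l
      using norm_triangle_ineq4[of "bohr_coeff f l" "bohr_coeff ?h l"] f pA
      by (simp add: bohr_coeff_diff APW_AP iff)
    then have "(\<Sum>l\<in>?F. cmod (bohr_coeff p l)) \<le> (\<Sum>l\<in>?F. cmod (bohr_coeff f l)) + (\<Sum>l\<in>?F. cmod (bohr_coeff ?h l))"
      unfolding sum.distrib[symmetric] by (intro sum_mono)
    also have "\<dots> \<le> wiener_norm f + wiener_norm ?h"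
      using f hA F(1) unfolding iff by (intro add_mono sum_bohr_coeff_le_wiener_norm) auto
    finally have "cmod (\<phi> p) \<le> wiener_norm f + d"
      using poly_le[OF F, of "bohr_coeff p"] trig_polys_eq_trig_sum[OF F(1) p(1) order_refl] p(2) by simp
    moreover have "cmod (\<phi> ?h) \<le> C * d"
      using C(2)[OF hA wiener_norm_nonneg] mult_left_mono[OF p(2) C(1)] by linarith
    moreover have "\<phi> f = \<phi> ?h + \<phi> p" using add_\<phi>[OF hA pA] by simp
    ultimately show "cmod (\<phi> f) \<le> wiener_norm f + e"
      using norm_triangle_ineq[of "\<phi> ?h" "\<phi> p"] d(2) by (simp add: distrib_right)
  qed
qed

theorem theorem3p1:
  fixes S \<Sigma> :: "(real ^ 'n) set"
  assumes "is_halfspace S"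
    and "\<Sigma> \<subseteq> S"
    and "0 \<in> \<Sigma>"
    and "\<And>l m. l \<in> \<Sigma> \<Longrightarrow> m \<in> \<Sigma> \<Longrightarrow> l + m \<in> \<Sigma>"
  shows "contractible_space (max_ideal_space (AP_spec \<Sigma>) sup_norm) \<and>
         contractible_space (max_ideal_space (APW_spec \<Sigma>) wiener_norm)"
proof -
  obtain \<omega> where "contracting_path \<Sigma> \<omega>"
    using halfspace_contracting_path[OF assms(1,2)] by blast
  then show ?thesis
    using function_algebra.contractible_max_ideal_space[OF function_algebra_AP_spec[OF assms(3,4)]]
      function_algebra.contractible_max_ideal_space[OF function_algebra_APW_spec[OF assms(3,4)]]
    by blast
qed

end
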